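(* Every unipotent $PI$-representation is locally unitriangular. That is, if $K$ is a field, $V$ is a $K$-module, and $(V,G)$ is a representation of a group $G$ in $V$ which is both a unipotent representation and a $PI$-representation, then for every finitely generated subgroup $H$ of $G$ the subrepresentation $(V,H)$ is unitriangular.
   Context: Let $K$ be a field and $V$ a $K$-module (vector space, not assumed finite-dimensional). A representation $(V,G)$ of a group $G$ in $V$ is a homomorphism $\rho:G\to \mathrm{Aut}\,V$, $g\mapsto g^{\rho}$; it is written as a right action $v\circ g=g^{\rho}(v)$, with $v\circ(gh)=(v\circ g)\circ h$, and extends linearly to an action of the group algebra $KG$ on $V$. For a subgroup $H\le G$, $(V,H)$ denotes the restriction of the representation to $H$. An element $g\in G$ is a unipotent element of $(V,G)$ if there is $n=n(g)$ such that $x\circ (g-1)^{n}=0$ for every $x\in V$. The representation $(V,G)$ is unipotent if every $g\in G$ is a unipotent element of $(V,G)$. The representation $(V,G)$ is unitriangular if for some $n$ it satisfies the identity $x\circ (y_1-1)\cdots (y_n-1)\equiv 0$, i.e. $v\circ (g_1-1)\cdots(g_n-1)=0$ for all $v\in V$ and all $g_1,\dots,g_n\in G$. It is locally unitriangular if for every finitely generated subgroup $H$ of $G$ the subrepresentation $(V,H)$ is unitriangular. Let $\mathrm{Ker}(V,G)=\{g\in G: v\circ g=v \text{ for all } v\in V\}$ and $\overline G=G/\mathrm{Ker}(V,G)$, regarded as a subgroup of $\mathrm{Aut}\,V$ via the corresponding faithful representation $(V,\overline G)$. The representation $(V,G)$ is a $PI$-representation if the linear span $\langle\overline G\rangle$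 of $\overline G$ in the algebra $\mathrm{End}\,V$ (of $K$-linear endomorphisms of $V$) is a $PI$-algebra, i.e. satisfies some non-trivial polynomial identity over $K$. *)

theory Defs
  imports
    Complex_Main
    "HOL-Algebra.Coset"
    "HOL-Algebra.Generated_Groups"
    "HOL-Library.Function_Algebras"
    "HOL-Library.Poly_Mapping"
begin

text \<open>
  Endomorphisms are functions on the underlying type of the vector space. As they are written on
  the right of their arguments, the product of \<open>f\<close> and \<open>g\<close> is ``first \<open>f\<close>, then \<open>g\<close>''.
\<close>

definition aut_group :: "('k::field \<Rightarrow> 'v \<Rightarrow> 'v::ab_group_add) \<Rightarrow> ('v \<Rightarrow> 'v) monoid" where
  "aut_group scale =
     \<lparr>carrier = {f. Vector_Spaces.linear scale scale f \<and> bij f}, mult = (\<lambda>f g. g \<circ> f), one = id\<rparr>"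

lemma group_aut_group:
  assumes "vector_space scale"
  shows "group (aut_group scale)"
proof (rule groupI)
  interpret vector_space scale by fact
  show "\<one>\<^bsub>aut_group scale\<^esub> \<in> carrier (aut_group scale)"
    by (simp add: aut_group_def linear_id)
  fix f assume f: "f \<in> carrier (aut_group scale)"
  then have "bij f" by (simp add: aut_group_def)
  have "inv_into UNIV f \<in> carrier (aut_group scale)"
    using f by (auto simp: aut_group_def bij_imp_bij_inv bij_module_hom_imp_inv_module_hom
        simp flip: module_hom_iff_linear)
  moreover have "inv_into UNIV f \<otimes>\<^bsub>aut_group scale\<^esub> f = \<one>\<^bsub>aut_group scale\<^esub>"
    using \<open>bij f\<close> by (auto simp: aut_group_def bij_is_surj surj_f_inv_f)
  ultimately show "\<exists>g\<in>carrier (aut_group scale). g \<otimes>\<^bsub>aut_group scale\<^esub> f = \<one>\<^bsub>aut_group scale\<^esub>"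
    by blast
qed (auto simp: aut_group_def bij_comp o_assoc module_hom_compose simp flip: module_hom_iff_linear)

text \<open>Here \<open>\<rho> g v\<close> stands for $v \circ g$; the vector space \<open>V\<close> is the whole type \<open>'v\<close>.\<close>

locale group_representation = vector_space scale + group G
  for scale :: "'k::field \<Rightarrow> 'v \<Rightarrow> 'v::ab_group_add"
    and G :: "('g, 'm) monoid_scheme" (structure) +
  fixes \<rho> :: "'g \<Rightarrow> 'v \<Rightarrow> 'v"
  assumes hom: "\<rho> \<in> hom G (aut_group scale)"
begin

lemma action_mult:
  "g \<in> carrier G \<Longrightarrow> h \<in> carrier G \<Longrightarrow> \<rho> (g \<otimes> h) v = \<rho> h (\<rho> g v)"
  using hom by (simp add: hom_def aut_group_def)

end

text \<open>The action of the element $g - 1$ of the group algebra.\<close>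

definition act_minus_one :: "('g \<Rightarrow> 'v \<Rightarrow> 'v::ab_group_add) \<Rightarrow> 'g \<Rightarrow> 'v \<Rightarrow> 'v" where
  "act_minus_one \<rho> g v = \<rho> g v - v"

definition unipotent_element :: "('g \<Rightarrow> 'v \<Rightarrow> 'v::ab_group_add) \<Rightarrow> 'g \<Rightarrow> bool" where
  "unipotent_element \<rho> g \<longleftrightarrow> (\<exists>n. \<forall>x. (act_minus_one \<rho> g ^^ n) x = 0)"

definition unipotent_rep ::
  "('g, 'm) monoid_scheme \<Rightarrow> ('g \<Rightarrow> 'v \<Rightarrow> 'v::ab_group_add) \<Rightarrow> bool" where
  "unipotent_rep G \<rho> \<longleftrightarrow> (\<forall>g\<in>carrier G. unipotent_element \<rho> g)"

text \<open>\<open>fold (act_minus_one \<rho>) [g\<^sub>1, \<dots>, g\<^sub>n] v\<close> is $v \circ (g_1 - 1) \cdots (g_n - 1)$.\<close>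

definition unitriangular_rep ::
  "('g, 'm) monoid_scheme \<Rightarrow> ('g \<Rightarrow> 'v \<Rightarrow> 'v::ab_group_add) \<Rightarrow> bool" where
  "unitriangular_rep G \<rho> \<longleftrightarrow>
     (\<exists>n. \<forall>v gs. length gs = n \<and> set gs \<subseteq> carrier G \<longrightarrow> fold (act_minus_one \<rho>) gs v = 0)"

definition finitely_generated_subgroup :: "('g, 'm) monoid_scheme \<Rightarrow> 'g set \<Rightarrow> bool" where
  "finitely_generated_subgroup G H \<longleftrightarrow>
     subgroup H G \<and> (\<exists>S. finite S \<and> S \<subseteq> carrier G \<and> H = generate G S)"

definition locally_unitriangular_rep ::
  "('g, 'm) monoid_scheme \<Rightarrow> ('g \<Rightarrow> 'v \<Rightarrow> 'v::ab_group_add) \<Rightarrow> bool" where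
  "locally_unitriangular_rep G \<rho> \<longleftrightarrow>
     (\<forall>H. finitely_generated_subgroup G H \<longrightarrow> unitriangular_rep (G\<lparr>carrier := H\<rparr>) \<rho>)"

text \<open>
  The subgroup of $\mathrm{Aut}\,V$ obtained from the faithful representation of
  $G/\mathrm{Ker}(V,G)$ induced by \<open>\<rho>\<close>.
\<close>

definition faithful_image ::
  "('k::field \<Rightarrow> 'v \<Rightarrow> 'v::ab_group_add) \<Rightarrow> ('g, 'm) monoid_scheme \<Rightarrow> ('g \<Rightarrow> 'v \<Rightarrow> 'v)
    \<Rightarrow> ('v \<Rightarrow> 'v) set" where
  "faithful_image scale G \<rho> =
     (\<lambda>C. the_elem (\<rho> ` C)) ` carrier (G Mod kernel G (aut_group scale) \<rho>)"

lemma (in group_representation) faithful_image_eq: "faithful_image scale G \<rho> = \<rho> ` carrier G"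
proof -
  interpret \<rho>: group_hom G "aut_group scale" \<rho>
    by (simp add: group_hom_def group_hom_axioms_def hom group_aut_group is_group vector_space_axioms)
  have "\<rho> ` (kernel G (aut_group scale) \<rho> #> g) = {\<rho> g}" if "g \<in> carrier G" for g
    using that one_closed by (force simp: kernel_def r_coset_def)
  then show ?thesis
    by (auto simp: faithful_image_def carrier_FactGroup image_image intro!: image_cong)
qed

text \<open>
  Elements of the free associative algebra $K\langle x_0, x_1, \dots\rangle$ are finitely supported
  functions on words in the indices of the variables. \<open>nc_eval scale p \<phi>\<close> substitutes the
  endomorphism \<open>\<phi> i\<close> for $x_i$, and \<open>fold \<phi> w\<close> is the product of the endomorphisms along \<open>w\<close>.
\<close>

definition nc_eval ::
  "('k::field \<Rightarrow> 'v \<Rightarrow> 'v::ab_group_add) \<Rightarrow> (nat list \<Rightarrow>\<^sub>0 'k) \<Rightarrow> (nat \<Rightarrow> 'v \<Rightarrow> 'v) \<Rightarrow> 'v \<Rightarrow> 'v" where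
  "nc_eval scale p \<phi> v =
     (\<Sum>w\<in>Poly_Mapping.keys p. scale (Poly_Mapping.lookup p w) (fold \<phi> w v))"

text \<open>
  The subalgebras \<open>A\<close> of $\mathrm{End}\,V$ to which this is applied contain the identity map, so
  polynomials with a constant term are meaningful.
\<close>

definition PI_algebra ::
  "('k::field \<Rightarrow> 'v \<Rightarrow> 'v::ab_group_add) \<Rightarrow> ('v \<Rightarrow> 'v) set \<Rightarrow> bool" where
  "PI_algebra scale A \<longleftrightarrow>
     (\<exists>p. p \<noteq> 0 \<and> (\<forall>\<phi>. range \<phi> \<subseteq> A \<longrightarrow> (\<forall>v. nc_eval scale p \<phi> v = 0)))"

definition PI_rep ::
  "('k::field \<Rightarrow> 'v \<Rightarrow> 'v::ab_group_add) \<Rightarrow> ('g, 'm) monoid_scheme \<Rightarrow> ('g \<Rightarrow> 'v \<Rightarrow> 'v) \<Rightarrow> bool" where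
  "PI_rep scale G \<rho> \<longleftrightarrow>
     PI_algebra scale (module.span (\<lambda>c f v. scale c (f v)) (faithful_image scale G \<rho>))"

end

theory Submission
  imports
    Defs
    "HOL-Algebra.Algebraic_Closure_Type"
    "HOL-Library.List_Lenlexorder"
    "HOL-Library.Multiset"
begin

text \<open>
  Let \<open>H\<close> be generated by a finite set closed under inversion, so that the span of \<open>H\<close> in
  $\mathrm{End}\,V$ is spanned by words in the generators. By the well-order on words (length
  first, then lexicographic) it is spanned by those words that are not combinations of smaller
  ones. If there were infinitely many of these, an infinite word would have only such factors.
  However, an infinite word over a finite alphabet either has many recurrent factors of some
  length, and then some factor $v_1 \cdots v_d$ decreases under every permutation of the $v_i$, so
  that a multilinear identity rewrites it by smaller words; or it is ultimately periodic and
  contains all powers of some \<open>u\<close>, and then $(u - 1)^n = 0$ rewrites $u^n$. Hence the span of \<open>H\<close>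
  is finite-dimensional, and Kolchin's theorem applies to the action of \<open>H\<close> on it.

  Kolchin's theorem is reduced to an algebraically closed field. There, on an irreducible module,
  all elements of the ideal spanned by the differences \<open>s - t\<close> have trace zero, whereas a nonzero
  element of this ideal of minimal rank has rank one and a multiple of trace one.
\<close>

section \<open>Endomorphisms of a vector space\<close>

lemma fun_sum_apply: "(\<Sum>a\<in>A. f a) x = (\<Sum>a\<in>A. f a x)"
  for f :: "'a \<Rightarrow> 'b \<Rightarrow> 'c::comm_monoid_add"
  by (induction A rule: infinite_finite_induct) simp_all

text \<open>A separate locale allows the results to be interpreted again on other spaces: on maps
  with pointwise scaling, and on coordinate vectors over an algebraic closure.\<close>

locale linear_endos = vector_space scale
  for scale :: "'a::field \<Rightarrow> 'b::ab_group_add \<Rightarrow> 'b" (infixr "*s" 75)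
begin

abbreviation lin :: "('b \<Rightarrow> 'b) \<Rightarrow> bool" where
  "lin f \<equiv> Vector_Spaces.linear scale scale f"

lemma lin_iff: "lin f \<longleftrightarrow> (\<forall>x y. f (x + y) = f x + f y) \<and> (\<forall>c x. f (c *s x) = c *s f x)"
  by (simp add: Vector_Spaces.linear_iff vector_space_axioms)

lemma lin_module_hom: "lin f \<Longrightarrow> module_hom scale scale f"
  by (simp add: module_hom_iff_linear)

lemmas lin_0 = module_hom.zero[OF lin_module_hom]
  and lin_add = module_hom.add[OF lin_module_hom]
  and lin_diff = module_hom.diff[OF lin_module_hom]
  and lin_scale = module_hom.scale[OF lin_module_hom]
  and lin_sum = module_hom.sum[OF lin_module_hom]

section \<open>Finite-dimensional subspaces of a space of arbitrary dimension\<close>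

definition fin_dim :: "'b set \<Rightarrow> bool" where
  "fin_dim W \<longleftrightarrow> subspace W \<and> (\<exists>B. finite B \<and> W \<subseteq> span B)"

lemma fin_dim_subspace: "fin_dim W \<Longrightarrow> subspace W"
  by (simp add: fin_dim_def)

lemma fin_dim_span: "finite B \<Longrightarrow> fin_dim (span B)"
  by (auto simp: fin_dim_def)

lemma fin_dim_basis_extend:
  assumes "fin_dim W" "independent A" "A \<subseteq> W"
  obtains B where "A \<subseteq> B" "finite B" "independent B" "span B = W" "card B = dim W"
proof -
  obtain F where F: "finite F" "W \<subseteq> span F" and W: "subspace W"
    using assms(1) by (auto simp: fin_dim_def)
  obtain B where B: "A \<subseteq> B" "B \<subseteq> W" "independent B" "W \<subseteq> span B"
    using maximal_independent_subset_extend[OF assms(3,2)] by blast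
  moreover have "finite B"
    using independent_span_bound[OF F(1) B(3)] B(2) F(2) by blast
  moreover have "span B = W" using span_subspace B W by blast
  moreover have "card B = dim W" using basis_card_eq_dim B by blast
  ultimately show thesis using that by blast
qed

lemma fin_dim_basis:
  assumes "fin_dim W"
  obtains B where "finite B" "independent B" "span B = W" "card B = dim W"
  using fin_dim_basis_extend[OF assms independent_empty] by auto

lemma fin_dim_subset:
  assumes "fin_dim W" "subspace U" "U \<subseteq> W"
  shows "fin_dim U"
  using assms by (auto simp: fin_dim_def)

lemma dim_psubset_fin_dim:
  assumes "fin_dim W" "subspace U" "U \<subset> W"
  shows "dim U < dim W"
proof -
  obtain A where A: "finite A" "independent A" "span A = U" "card A = dim U"
    using fin_dim_basis[OF fin_dim_subset[OF assms(1,2)]] assms(3) by blast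
  obtain B where B: "A \<subseteq> B" "finite B" "independent B" "span B = W" "card B = dim W"
    using fin_dim_basis_extend[OF assms(1) A(2)] A(3) assms(3) span_superset by blast
  then have "A \<subset> B" using A assms(3) by blast
  then show ?thesis using A B psubset_card_mono by metis
qed

lemma lin_image_fin_dim:
  assumes "lin f" "fin_dim W"
  shows "fin_dim (f ` W)"
proof -
  interpret f: module_hom scale scale f using assms(1) by (rule lin_module_hom)
  obtain B where "finite B" "span B = W" using fin_dim_basis[OF assms(2)] by blast
  then show ?thesis using f.span_image[of B] fin_dim_span[of "f ` B"] by simp
qed

text \<open>Complete \<open>z\<close> to a basis of \<open>W\<close>: the images of the other basis
  vectors already span the image of \<open>W\<close>.\<close>

lemma dim_image_less:
  assumes "lin f" "fin_dim W" "z \<in> W" "z \<noteq> 0" "f z = 0"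
  shows "dim (f ` W) < dim W"
proof -
  interpret f: module_hom scale scale f using assms(1) by (rule lin_module_hom)
  obtain B where B: "{z} \<subseteq> B" "finite B" "independent B" "span B = W" "card B = dim W"
    using fin_dim_basis_extend[OF assms(2), of "{z}"] assms(3,4) by auto
  have "f ` W = span (f ` B)" using f.span_image[of B] B by simp
  also have "f ` B = insert 0 (f ` (B - {z}))" using B(1) assms(5) by auto
  finally have *: "f ` W \<subseteq> span (f ` (B - {z}))" by simp
  have "dim (f ` W) \<le> card (f ` (B - {z}))" by (rule dim_le_card[OF *]) (use B in auto)
  also have "\<dots> \<le> card (B - {z})" using B by (intro card_image_le) auto
  also have "\<dots> < card B" using B by (intro psubset_card_mono) auto
  finally show ?thesis using B by simp
qed

section \<open>The trace on a finite-dimensional subspace, in coordinates\<close>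

definition tr :: "'b set \<Rightarrow> ('b \<Rightarrow> 'b) \<Rightarrow> 'a" where
  "tr B f = (\<Sum>b\<in>B. representation B (f b) b)"

lemma representation_lin:
  assumes "finite B" "independent B" "independent C" "lin f" "f ` span B \<subseteq> span C" "x \<in> span B"
  shows "representation C (f x) c = (\<Sum>b\<in>B. representation B x b * representation C (f b) c)"
proof -
  have *: "f b \<in> span C" if "b \<in> B" for b using that assms(5) span_base by blast
  have "x = (\<Sum>b\<in>B. representation B x b *s b)"
    using sum_representation_eq[OF assms(2,6,1)] by simp
  then have "f x = (\<Sum>b\<in>B. representation B x b *s f b)"
    by (metis (no_types, lifting) lin_scale[OF assms(4)] lin_sum[OF assms(4)] sum.cong)
  then show ?thesis
    using * assms(3) by (simp add: representation_sum representation_scale span_scale)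
qed

text \<open>Inserting the other basis turns both traces into the same double sum over
  \<open>B\<close> and \<open>C\<close>, up to the order of summation.\<close>

lemma tr_basis_indep:
  assumes "finite B" "independent B" "finite C" "independent C" "span B = span C"
    and "lin f" "f ` span B \<subseteq> span B"
  shows "tr B f = tr C f"
proof -
  have f: "f b \<in> span B" if "b \<in> span B" for b using that assms(7) by blast
  have "tr B f = (\<Sum>b\<in>B. \<Sum>c\<in>C. representation C (f b) c * representation B c b)"
    unfolding tr_def
  proof (intro sum.cong refl)
    fix b assume "b \<in> B"
    then have "f b \<in> span C" using f span_base assms(5) by blast
    then show "representation B (f b) b = (\<Sum>c\<in>C. representation C (f b) c * representation B c b)"
      using representation_lin[OF assms(3,4,2) linear_id, of "f b" b] assms(5) by simp
  qed
  also have "\<dots> = (\<Sum>c\<in>C. \<Sum>b\<in>B. representation B c b * representation C (f b) c)"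
    by (subst sum.swap) (simp add: mult.commute)
  also have "\<dots> = tr C f"
    unfolding tr_def
  proof (intro sum.cong refl)
    fix c assume "c \<in> C"
    then have "c \<in> span B" using span_base assms(5) by blast
    then show "(\<Sum>b\<in>B. representation B c b * representation C (f b) c) = representation C (f c) c"
      using representation_lin[OF assms(1,2,4,6), of c c] assms(5,7) by simp
  qed
  finally show ?thesis .
qed

lemma funpow_image_subset: "f ` W \<subseteq> W \<Longrightarrow> x \<in> W \<Longrightarrow> (f ^^ n) x \<in> W"
  by (induction n) auto

text \<open>Induction on the dimension. If \<open>f\<close> maps the span onto itself, so does its
  \<open>n\<close>-th power, and the space is zero. Otherwise the trace can be computed on the
  proper subspace of values of \<open>f\<close>.\<close>

lemma tr_nilpotent:
  assumes "finite B" "independent B" "lin f" "f ` span B \<subseteq> span B"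
    and "\<And>x. x \<in> span B \<Longrightarrow> (f ^^ n) x = 0"
  shows "tr B f = 0"
  using assms
proof (induction "card B" arbitrary: B rule: less_induct)
  case less
  define W where "W = span B"
  have W: "fin_dim W" using less.prems by (simp add: W_def fin_dim_span)
  show ?case
  proof (cases "f ` W = W")
    case True
    then have "(f ^^ n) ` W = W" by (induction n) (simp_all only: funpow.simps image_comp[symmetric] image_id id_apply)
    moreover have "(f ^^ n) x = 0" if "x \<in> W" for x using less.prems(5) that W_def by simp
    ultimately have "W \<subseteq> {0}" by force
    then have "B \<subseteq> {0}" using span_superset[of B] W_def by blast
    moreover have "0 \<notin> B" using less.prems(2) dependent_zero by blast
    ultimately have "B = {}" by blast
    then show ?thesis by (simp add: tr_def)
  next
    case False
    have sub: "f ` W \<subseteq> W" using less.prems(4) W_def by simp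
    obtain C where C: "finite C" "independent C" "span C = f ` W" "card C = dim (f ` W)"
      using fin_dim_basis[OF lin_image_fin_dim[OF less.prems(3) W]] by blast
    have "C \<subseteq> W" using sub span_superset[of C] C(3) by blast
    then obtain D where D: "C \<subseteq> D" "finite D" "independent D" "span D = W"
      using fin_dim_basis_extend[OF W C(2)] by metis
    have "dim (f ` W) < dim W"
      using fin_dim_subspace[OF lin_image_fin_dim[OF less.prems(3) W]] False sub
      by (intro dim_psubset_fin_dim[OF W] psubsetI)
    moreover have "dim W = card B"
      unfolding W_def using less.prems(2) by (rule dim_span_eq_card_independent)
    ultimately have "card C < card B" using C(4) by simp
    moreover have "f ` span C \<subseteq> span C" using C(3) sub by (simp add: image_mono)
    moreover have "(f ^^ n) x = 0" if "x \<in> span C" for x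
      using that C(3) sub less.prems(5) W_def by blast
    ultimately have "tr C f = 0"
      using less.hyps C(1,2) less.prems(3) by blast
    have fD: "f d \<in> span C" if "d \<in> D" for d
      using span_base[OF that] D(4) C(3) by simp
    have "tr B f = tr D f"
      using tr_basis_indep[OF less.prems(1,2) D(2,3) _ less.prems(3,4)] D(4) W_def by simp
    also have "\<dots> = (\<Sum>d\<in>D. representation C (f d) d)"
      unfolding tr_def using representation_extend[OF D(3) fD D(1)] by (intro sum.cong) auto
    \<comment> \<open>A vector of \<open>D\<close> outside \<open>C\<close> contributes nothing,
      since every \<open>f d\<close> has coordinates in \<open>C\<close> only.\<close>
    also have "\<dots> = tr C f"
      unfolding tr_def using D representation_ne_zero
      by (intro sum.mono_neutral_right) auto
    finally show ?thesis using \<open>tr C f = 0\<close> by simp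
  qed
qed

lemma tr_add:
  assumes "independent B" "f ` span B \<subseteq> span B" "g ` span B \<subseteq> span B"
  shows "tr B (f + g) = tr B f + tr B g"
proof -
  have "f b \<in> span B" "g b \<in> span B" if "b \<in> B" for b using that assms span_base by blast+
  then show ?thesis using assms(1) by (simp add: tr_def representation_add sum.distrib)
qed

lemma tr_scale:
  assumes "independent B" "f ` span B \<subseteq> span B"
  shows "tr B (\<lambda>x. c *s f x) = c * tr B f"
proof -
  have "f b \<in> span B" if "b \<in> B" for b using that assms span_base by blast
  then show ?thesis using assms(1) by (simp add: tr_def representation_scale sum_distrib_left)
qed

text \<open>In a basis containing \<open>u\<close>, all values of \<open>f\<close> are multiples of
  \<open>u\<close>, so the only nonzero diagonal entry is the one at \<open>u\<close>.\<close>

lemma tr_rank_one: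
  assumes "finite B" "independent B" "lin f" "f ` span B \<subseteq> span {u}" "u \<in> span B" "u \<noteq> 0" "f u = u"
  shows "tr B f = 1"
proof -
  have "independent {u}" "{u} \<subseteq> span B" using assms(5,6) by simp_all
  then obtain C where C: "{u} \<subseteq> C" "finite C" "independent C" "span C = span B"
    using fin_dim_basis_extend[OF fin_dim_span[OF assms(1)]] by metis
  have "span {u} \<subseteq> span B" using assms(5) by (simp add: span_minimal)
  then have "tr B f = tr C f"
    by (intro tr_basis_indep[OF assms(1,2) C(2,3) C(4)[symmetric] assms(3)] subset_trans[OF assms(4)])
  also have "\<dots> = (\<Sum>c\<in>C. if c = u then 1 else 0)"
    unfolding tr_def
  proof (intro sum.cong refl)
    fix c assume c: "c \<in> C"
    show "representation C (f c) c = (if c = u then 1 else 0)"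
    proof (cases "c = u")
      case True
      then show ?thesis using C c assms(7) representation_basis by simp
    next
      case False
      have "c \<in> span B" using span_base[OF c] C(4) by simp
      then have "f c \<in> span {u}" using assms(4) by blast
      then obtain k where "f c = k *s u" by (auto simp: span_singleton)
      moreover have "representation C u c = 0"
        using False C representation_basis[of C u] by simp
      ultimately show ?thesis
        using False \<open>f c = k *s u\<close> representation_scale[OF C(3) span_base, of u k] C(1) by simp
    qed
  qed
  also have "\<dots> = 1" using C by simp
  finally show ?thesis .
qed

section \<open>Polynomials in an endomorphism, evaluated at a vector by Horner's scheme\<close>

definition poly_act :: "('b \<Rightarrow> 'b) \<Rightarrow> 'a poly \<Rightarrow> 'b \<Rightarrow> 'b" where
  "poly_act f p x = fold_coeffs (\<lambda>c y. c *s x + f y) p 0"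

lemma poly_act_0 [simp]: "poly_act f 0 x = 0"
  by (simp add: poly_act_def)

lemma poly_act_pCons:
  assumes "lin f"
  shows "poly_act f (pCons c p) x = c *s x + f (poly_act f p x)"
  by (cases "p = 0 \<and> c = 0") (auto simp: poly_act_def lin_0[OF assms])

lemma poly_act_add:
  assumes "lin f"
  shows "poly_act f (p + q) x = poly_act f p x + poly_act f q x"
  by (induction p q rule: poly_induct2)
    (simp_all add: poly_act_pCons assms scale_left_distrib lin_add[OF assms])

lemma poly_act_smult:
  assumes "lin f"
  shows "poly_act f (smult c p) x = c *s poly_act f p x"
  by (induction p)
    (simp_all add: poly_act_pCons assms scale_right_distrib lin_scale[OF assms])

lemma poly_act_monom:
  assumes "lin f"
  shows "poly_act f (monom c n) x = c *s (f ^^ n) x"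
  by (induction n) (simp_all add: poly_act_pCons assms monom_0 monom_Suc lin_0[OF assms] lin_scale[OF assms])

lemma poly_act_sum:
  assumes "lin f"
  shows "poly_act f (\<Sum>i\<in>F. p i) x = (\<Sum>i\<in>F. poly_act f (p i) x)"
  by (induction F rule: infinite_finite_induct) (simp_all add: poly_act_add assms)

lemma poly_act_linear_factor:
  assumes "lin f"
  shows "poly_act f ([:- c, 1:] * q) x = f (poly_act f q x) - c *s poly_act f q x"
proof -
  have "[:- c, 1:] * q = pCons 0 q + smult (- c) q" by simp
  then show ?thesis
    by (simp only: poly_act_add[OF assms] poly_act_smult[OF assms] poly_act_pCons[OF assms]) simp
qed

lemma poly_act_in:
  assumes "lin f" "subspace M" "f ` M \<subseteq> M" "x \<in> M"
  shows "poly_act f p x \<in> M"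
proof (induction p)
  case 0
  then show ?case using assms subspace_0 by simp
next
  case (pCons a p)
  then have "f (poly_act f p x) \<in> M" using assms by blast
  then show ?case using assms by (simp add: poly_act_pCons subspace_add subspace_scale)
qed

text \<open>The iterates of \<open>x\<close> with exponents up to \<open>card B\<close> are too many
  to be independent. As \<open>dependent\<close> speaks of sets, coinciding iterates are treated
  apart; they give the polynomial \<open>X^i - X^j\<close>.\<close>

lemma poly_act_annihilator:
  assumes "fin_dim M" "lin f" "f ` M \<subseteq> M" "x \<in> M"
  obtains p where "p \<noteq> 0" "poly_act f p x = 0"
proof -
  let ?v = "\<lambda>i. (f ^^ i) x"
  obtain B where B: "finite B" "span B = M" using fin_dim_basis[OF assms(1)] by blast
  show thesis
  proof (cases "inj_on ?v {..card B}")
    case True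
    have "?v ` {..card B} \<subseteq> span B" using funpow_image_subset[OF assms(3,4)] B by blast
    moreover have "card (?v ` {..card B}) = Suc (card B)" using True by (simp add: card_image)
    ultimately have "dependent (?v ` {..card B})"
      using independent_span_bound[OF B(1)] by (metis not_less_eq_eq order_refl)
    then obtain u i where u: "i \<le> card B" "u (?v i) \<noteq> 0" "(\<Sum>v\<in>?v ` {..card B}. u v *s v) = 0"
      by (subst (asm) dependent_finite) auto
    let ?p = "\<Sum>i\<le>card B. monom (u (?v i)) i"
    have "coeff ?p i = u (?v i)" using u(1) by (simp add: coeff_sum)
    then have "?p \<noteq> 0" using u(2) by force
    moreover have "poly_act f ?p x = 0"
      using u(3) True by (simp add: poly_act_sum poly_act_monom assms(2) sum.reindex)
    ultimately show thesis by (rule that)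
  next
    case False
    then obtain i j where ij: "i \<noteq> j" "?v i = ?v j" by (auto simp: inj_on_def)
    have "coeff (monom 1 i + monom (-1) j) i = (1::'a)" using ij by simp
    then have "monom 1 i + monom (-1) j \<noteq> (0 :: 'a poly)" by force
    moreover have "poly_act f (monom 1 i + monom (-1) j) x = 0"
      using ij by (simp add: poly_act_add poly_act_monom assms(2))
    ultimately show thesis by (rule that)
  qed
qed

section \<open>The vector space of maps, and spans of endomorphisms\<close>

definition fun_scale :: "'a \<Rightarrow> ('c \<Rightarrow> 'b) \<Rightarrow> 'c \<Rightarrow> 'b" where
  "fun_scale c f = (\<lambda>x. c *s f x)"

lemma fun_scale_apply [simp]: "fun_scale c f x = c *s f x"
  by (simp add: fun_scale_def)

lemma vector_space_fun_scale: "vector_space fun_scale"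
  unfolding vector_space_def
  by (intro conjI allI ext) (simp_all add: scale_right_distrib scale_left_distrib)

sublocale E: vector_space "fun_scale :: 'a \<Rightarrow> ('b \<Rightarrow> 'b) \<Rightarrow> _"
  by (rule vector_space_fun_scale)

lemma comp_right_in_span:
  assumes "f \<in> E.span S"
  shows "f \<circ> g \<in> E.span ((\<lambda>s. s \<circ> g) ` S)"
  using assms
proof (induction rule: E.span_induct)
  case base
  have "(0 :: 'b \<Rightarrow> 'b) \<circ> g = 0" "fun_scale c f \<circ> g = fun_scale c (f \<circ> g)"
    "(f + h) \<circ> g = (f \<circ> g) + (h \<circ> g)" for c and f h :: "'b \<Rightarrow> 'b"
    by (auto simp: fun_eq_iff)
  then show ?case
    by (intro E.subspaceI; simp only: mem_Collect_eq E.span_add E.span_zero E.span_scale)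
next
  case (step s)
  then show ?case by (intro E.span_base imageI)
qed

lemma comp_left_in_span:
  assumes "lin f" "g \<in> E.span S"
  shows "f \<circ> g \<in> E.span ((\<lambda>s. f \<circ> s) ` S)"
  using assms(2)
proof (induction rule: E.span_induct)
  case base
  have "f \<circ> (0 :: 'b \<Rightarrow> 'b) = 0" "f \<circ> fun_scale c g = fun_scale c (f \<circ> g)"
    "f \<circ> (g + h) = (f \<circ> g) + (f \<circ> h)" for c and g h :: "'b \<Rightarrow> 'b"
    by (auto simp: lin_add[OF assms(1)] lin_scale[OF assms(1)] lin_0[OF assms(1)])
  then show ?case
    by (intro E.subspaceI; simp only: mem_Collect_eq E.span_add E.span_zero E.span_scale)
next
  case (step s)
  then show ?case by (intro E.span_base imageI)
qed

lemma comp_in_span: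
  assumes "\<And>s. s \<in> S \<Longrightarrow> lin s" "\<And>s t. s \<in> S \<Longrightarrow> t \<in> T \<Longrightarrow> s \<circ> t \<in> E.span U"
    and "f \<in> E.span S" "g \<in> E.span T"
  shows "f \<circ> g \<in> E.span U"
proof -
  have "s \<circ> g \<in> E.span U" if "s \<in> S" for s
    using comp_left_in_span[OF assms(1)[OF that] assms(4)] assms(2)[OF that]
      E.span_minimal[of "(\<lambda>t. s \<circ> t) ` T" "E.span U"] by blast
  then show ?thesis
    using comp_right_in_span[OF assms(3), of g]
      E.span_minimal[of "(\<lambda>s. s \<circ> g) ` S" "E.span U"] by blast
qed

lemma lin_comp: "lin f \<Longrightarrow> lin g \<Longrightarrow> lin (f \<circ> g)"
  by (simp add: lin_iff)

lemma lin_fun_diff: "lin f \<Longrightarrow> lin g \<Longrightarrow> lin (f - g)"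
  by (simp add: lin_iff algebra_simps scale_right_diff_distrib)

lemma subspace_endos:
  assumes "subspace W"
  shows "E.subspace {f. lin f \<and> f ` W \<subseteq> W}"
  using assms
  by (auto simp: E.subspace_def lin_iff algebra_simps scale_right_distrib mult.commute image_subset_iff
      intro: subspace_0 subspace_add subspace_scale)

lemma lin_comb_closed:
  assumes "subspace W" "\<And>s. s \<in> S \<Longrightarrow> lin s \<and> s ` W \<subseteq> W" "f \<in> E.span S"
  shows "lin f \<and> f ` W \<subseteq> W"
  using E.span_minimal[OF _ subspace_endos[OF assms(1)], of S] assms(2,3) by blast

lemma subspace_orbit: "subspace ((\<lambda>f. f x) ` E.span S)"
proof (rule subspaceI)
  show "0 \<in> (\<lambda>f. f x) ` E.span S" by (rule image_eqI[OF _ E.span_zero]) simp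
  fix y z c assume "y \<in> (\<lambda>f. f x) ` E.span S"
  then obtain f where f: "f \<in> E.span S" "y = f x" by blast
  show "c *s y \<in> (\<lambda>f. f x) ` E.span S"
    by (rule image_eqI[OF _ E.span_scale[OF f(1), of c]]) (simp add: f(2))
  assume "z \<in> (\<lambda>f. f x) ` E.span S"
  then obtain g where g: "g \<in> E.span S" "z = g x" by blast
  show "y + z \<in> (\<lambda>f. f x) ` E.span S"
    by (rule image_eqI[OF _ E.span_add[OF f(1) g(1)]]) (simp add: f(2) g(2))
qed

text \<open>The neutral element \<open>e\<close> of the semigroups below acts as the identity only
  on \<open>W\<close>, so \<open>f - e\<close> replaces \<open>f - 1\<close> only there; invariance
  of \<open>W\<close> keeps the iteration inside.\<close>

lemma funpow_diff_id:
  assumes "\<And>x. x \<in> W \<Longrightarrow> e x = x" "subspace W" "f ` W \<subseteq> W" "x \<in> W"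
  shows "((f - e) ^^ n) x = ((\<lambda>y. f y - y) ^^ n) x"
proof -
  have "((f - e) ^^ n) x = ((\<lambda>y. f y - y) ^^ n) x \<and> ((\<lambda>y. f y - y) ^^ n) x \<in> W"
    using assms by (induction n) (auto intro!: subspace_diff)
  then show ?thesis ..
qed

text \<open>Each \<open>s - e\<close> is nilpotent on the span, hence of trace zero. The trace is
  linear, and \<open>s - t\<close> is a difference of two such elements.\<close>

lemma tr_augmentation:
  assumes B: "finite B" "independent B"
    and S: "\<And>s. s \<in> S \<Longrightarrow> lin s \<and> s ` span B \<subseteq> span B"
    and e: "e \<in> S" "\<And>x. x \<in> span B \<Longrightarrow> e x = x"
    and unip: "\<And>s. s \<in> S \<Longrightarrow> \<exists>n. \<forall>x\<in>span B. ((\<lambda>y. s y - y) ^^ n) x = 0"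
    and f: "f \<in> E.span {s - t |s t. s \<in> S \<and> t \<in> S}"
  shows "tr B f = 0"
proof -
  have endo: "lin (s - t) \<and> (s - t) ` span B \<subseteq> span B" if "s \<in> S" "t \<in> S" for s t
    using S that by (auto intro!: lin_fun_diff span_diff)
  have 0: "tr B (s - e) = 0" if "s \<in> S" for s
  proof -
    obtain n where n: "\<forall>x\<in>span B. ((\<lambda>y. s y - y) ^^ n) x = 0" using unip \<open>s \<in> S\<close> by blast
    have "((s - e) ^^ n) x = 0" if "x \<in> span B" for x
      using funpow_diff_id[OF e(2) subspace_span _ that, of s n] S[OF \<open>s \<in> S\<close>] n that by simp
    then show ?thesis using tr_nilpotent[OF B] endo[OF that e(1)] by blast
  qed
  have add: "tr B (g + h) = tr B g + tr B h"
    if "g ` span B \<subseteq> span B" "h ` span B \<subseteq> span B" for g h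
    using tr_add[OF B(2) that] .
  have scale: "tr B (fun_scale c g) = c * tr B g" if "g ` span B \<subseteq> span B" for g c
    using tr_scale[OF B(2) that] by (simp add: fun_scale_def)
  have base: "tr B (s - t) = 0" if "s \<in> S" "t \<in> S" for s t
  proof -
    have "s - e = (s - t) + (t - e)" by simp
    then have "tr B (s - e) = tr B (s - t) + tr B (t - e)"
      using add endo that e(1) by metis
    then show ?thesis using 0 that by simp
  qed
  have "E.subspace {g. (lin g \<and> g ` span B \<subseteq> span B) \<and> tr B g = 0}"
    using subspace_endos[OF subspace_span, of B] add scale
    unfolding E.subspace_def by (auto simp: tr_def representation_zero)
  moreover have "{s - t |s t. s \<in> S \<and> t \<in> S} \<subseteq> {g. (lin g \<and> g ` span B \<subseteq> span B) \<and> tr B g = 0}"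
    using endo base by blast
  ultimately show ?thesis using E.span_minimal f by blast
qed

text \<open>Extend a basis of \<open>U\<close> to the whole space and delete the
  \<open>U\<close>-coordinates. Such a \<open>\<pi>\<close> is a model of the quotient map modulo
  \<open>U\<close>.\<close>

lemma projection_along:
  assumes "fin_dim U"
  obtains \<pi> where "lin \<pi>" "\<And>x. \<pi> x = 0 \<longleftrightarrow> x \<in> U" "\<And>x. x - \<pi> x \<in> U"
proof -
  obtain A where A: "finite A" "independent A" "span A = U" using fin_dim_basis[OF assms] by blast
  obtain B where B: "A \<subseteq> B" "independent B" "UNIV \<subseteq> span B"
    using maximal_independent_subset_extend[OF subset_UNIV A(2)] by metis
  have span_B: "x \<in> span B" for x using B(3) by blast
  let ?p = "\<lambda>x. \<Sum>a\<in>A. representation B x a *s a"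
  have in_U: "?p x \<in> U" for x
    unfolding A(3)[symmetric] by (intro span_sum span_scale span_base)
  have fix_U: "?p x = x" if "x \<in> U" for x
    using sum_representation_eq[OF A(2) _ A(1), of x] representation_extend[OF B(2) _ B(1), of x] that A(3)
    by simp
  have "lin (\<lambda>x. x - ?p x)"
    by (simp add: lin_iff representation_add representation_scale span_B B(2) scale_left_distrib
        sum.distrib scale_sum_right scale_right_diff_distrib)
  moreover have "x - ?p x = 0 \<longleftrightarrow> x \<in> U" for x using in_U[of x] fix_U[of x] by (metis right_minus_eq)
  moreover have "x - (x - ?p x) \<in> U" for x using in_U by simp
  ultimately show thesis by (rule that)
qed

lemma lin_eq_on_span:
  assumes "lin f" "lin g" "\<And>b. b \<in> B \<Longrightarrow> f b = g b" "x \<in> span B"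
  shows "f x = g x"
proof -
  have "subspace {x. f x = g x}"
    using assms(1,2) by (auto simp: subspace_def lin_0 lin_add lin_scale)
  then show ?thesis using span_minimal[of B "{x. f x = g x}"] assms(3,4) by blast
qed

end

section \<open>Groups of unipotent transformations\<close>

locale linear_endos_closed = linear_endos scale
  for scale :: "'a::alg_closed_field \<Rightarrow> 'b::ab_group_add \<Rightarrow> 'b" (infixr "*s" 75)
begin

text \<open>An annihilating polynomial of \<open>x0\<close> of least degree has a root
  \<open>c\<close>. Dividing by \<open>X - c\<close> gives a polynomial that, by minimality, does
  not annihilate \<open>x0\<close>; it sends \<open>x0\<close> to an eigenvector.\<close>

lemma eigenvector_exists:
  assumes M: "fin_dim M" "x0 \<in> M" "x0 \<noteq> 0" and f: "lin f" "f ` M \<subseteq> M"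
  obtains z c where "z \<in> M" "z \<noteq> 0" "f z = c *s z"
proof -
  let ?P = "\<lambda>p. p \<noteq> 0 \<and> poly_act f p x0 = 0"
  obtain p where p: "?P p" and min: "\<And>q. ?P q \<Longrightarrow> degree p \<le> degree q"
    using ex_has_least_nat[of ?P _ degree] poly_act_annihilator[OF M(1) f M(2)] by metis
  have "degree p > 0"
  proof (rule ccontr)
    assume "\<not> degree p > 0"
    then obtain c where "p = [:c:]" by (auto elim: degree_eq_zeroE)
    with p M(3) show False by (simp add: poly_act_pCons f(1) lin_0)
  qed
  then obtain c where "poly p c = 0" using alg_closed_imp_poly_has_root by blast
  then obtain q where q: "p = [:- c, 1:] * q" by (auto simp: poly_eq_0_iff_dvd)
  with p have "q \<noteq> 0" by auto
  then have "degree q < degree p" by (subst q, subst degree_mult_eq) auto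
  then have "poly_act f q x0 \<noteq> 0" using min \<open>q \<noteq> 0\<close> by force
  moreover have "poly_act f q x0 \<in> M"
    using poly_act_in f M fin_dim_subspace by blast
  moreover have "f (poly_act f q x0) = c *s poly_act f q x0"
    using p poly_act_linear_factor[OF f(1)] q by simp
  ultimately show thesis using that by blast
qed

text \<open>If some \<open>s\<close> moved a vector of \<open>W\<close>, the ideal \<open>I\<close>
  would act nontrivially, and an element \<open>T\<close> of \<open>I\<close> of least positive rank
  on \<open>W\<close> would have rank one. Transitivity of the algebra \<open>A\<close> then yields
  \<open>R\<close> such that \<open>T \<circ> R\<close> has trace one, against
  \<open>tr_augmentation\<close>.\<close>

lemma unipotent_irreducible:
  assumes W: "fin_dim W"
    and lin: "\<And>s. s \<in> S \<Longrightarrow> lin s"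
    and inv: "\<And>s. s \<in> S \<Longrightarrow> s ` W \<subseteq> W"
    and comp: "\<And>s t. s \<in> S \<Longrightarrow> t \<in> S \<Longrightarrow> s \<circ> t \<in> S"
    and e: "e \<in> S" "\<And>x. x \<in> W \<Longrightarrow> e x = x"
    and unip: "\<And>s. s \<in> S \<Longrightarrow> \<exists>n. \<forall>x\<in>W. ((\<lambda>y. s y - y) ^^ n) x = 0"
    and irred: "\<And>U. subspace U \<Longrightarrow> U \<subseteq> W \<Longrightarrow> (\<And>s. s \<in> S \<Longrightarrow> s ` U \<subseteq> U) \<Longrightarrow> U = {0} \<or> U = W"
    and s: "s \<in> S" and x: "x \<in> W"
  shows "s x = x"
proof (rule ccontr)
  assume "s x \<noteq> x"
  define A where "A = E.span S"
  define D where "D = {s - t |s t. s \<in> S \<and> t \<in> S}"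
  define I where "I = E.span D"
  have SA: "s \<in> A" if "s \<in> S" for s using that by (simp add: A_def E.span_base)
  have DA: "d \<in> A" if "d \<in> D" for d
    using that unfolding D_def A_def by (blast intro: E.span_diff E.span_base)
  have IA: "f \<in> A" if "f \<in> I" for f
    using E.span_minimal[of D A] DA that unfolding I_def A_def by blast
  have subW: "subspace W" using W by (rule fin_dim_subspace)
  have A_lin: "lin f" and A_inv: "f ` W \<subseteq> W" if "f \<in> A" for f
    using lin_comb_closed[OF subW, of S f] lin inv that by (auto simp: A_def)
  have comp_diff: "(s - t) \<circ> r = (s \<circ> r) - (t \<circ> r)" for s t r :: "'b \<Rightarrow> 'b" by auto
  have comp_diff': "r \<circ> (s - t) = (r \<circ> s) - (r \<circ> t)" if "lin r" for s t r :: "'b \<Rightarrow> 'b"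
    using that by (auto simp: lin_diff)
  have SD: "s \<circ> d \<in> D" "d \<circ> s \<in> D" if sd: "s \<in> S" "d \<in> D" for s d
  proof -
    obtain p q where d: "d = p - q" "p \<in> S" "q \<in> S" using sd(2) unfolding D_def by blast
    have "s \<circ> d = (s \<circ> p) - (s \<circ> q)" "d \<circ> s = (p \<circ> s) - (q \<circ> s)"
      unfolding d(1) by (simp_all only: comp_diff comp_diff'[OF lin[OF sd(1)]])
    then show "s \<circ> d \<in> D" "d \<circ> s \<in> D" unfolding D_def using comp sd(1) d(2,3) by blast+
  qed
  have AA: "f \<circ> g \<in> A" if "f \<in> A" "g \<in> A" for f g
    unfolding A_def
    by (rule comp_in_span[OF _ _ that[unfolded A_def]]) (use lin comp E.span_base in auto)
  have AI: "f \<circ> g \<in> I" if "f \<in> A" "g \<in> I" for f g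
    unfolding I_def
    by (rule comp_in_span[OF _ _ that[unfolded A_def I_def]]) (use lin SD E.span_base in auto)
  have IA': "f \<circ> g \<in> I" if "f \<in> I" "g \<in> A" for f g
    unfolding I_def
    by (rule comp_in_span[OF _ _ that[unfolded A_def I_def]]) (use A_lin DA SD E.span_base in auto)
  \<comment> \<open>The orbit of \<open>y\<close> under \<open>A\<close> is an invariant subspace
    and contains \<open>y\<close> because of \<open>e\<close>, so by irreducibility it is all of
    \<open>W\<close>.\<close>
  have transitive: "\<exists>f\<in>A. f y = z" if "y \<in> W" "y \<noteq> 0" "z \<in> W" for y z
  proof -
    let ?U = "(\<lambda>f. f y) ` A"
    have "subspace ?U" unfolding A_def by (rule subspace_orbit)
    moreover have "?U \<subseteq> W" using A_inv that(1) by blast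
    moreover have "s ` ?U \<subseteq> ?U" if "s \<in> S" for s
      using AA[OF SA[OF that]] by (auto simp: image_iff) (metis comp_apply)
    ultimately have "?U = {0} \<or> ?U = W" by (rule irred)
    moreover have "y \<in> ?U"
      using rev_image_eqI[OF SA[OF e(1)], of y "\<lambda>f. f y"] e(2)[OF that(1)] by simp
    ultimately show ?thesis using that(2,3) by (metis (no_types, lifting) imageE singletonD)
  qed
  let ?P = "\<lambda>f. f \<in> I \<and> (\<exists>y\<in>W. f y \<noteq> 0)"
  have "?P (s - e)"
    using \<open>s x \<noteq> x\<close> s x e by (auto simp: I_def D_def intro!: E.span_base)
  then obtain T where T: "T \<in> I" "\<exists>y\<in>W. T y \<noteq> 0"
    and min: "\<And>f. ?P f \<Longrightarrow> dim (T ` W) \<le> dim (f ` W)"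
    using ex_has_least_nat[of ?P "s - e" "\<lambda>f. dim (f ` W)"] by blast
  then obtain x1 where x1: "x1 \<in> W" "T x1 \<noteq> 0" by blast
  have linT: "lin T" and invT: "T ` W \<subseteq> W" using T(1) IA A_lin A_inv by blast+
  have TW: "fin_dim (T ` W)" by (rule lin_image_fin_dim[OF linT W])
  have rank_one: "T ` W \<subseteq> span {T x1}"
  proof (rule ccontr)
    assume "\<not> T ` W \<subseteq> span {T x1}"
    then obtain x2 where x2: "x2 \<in> W" "T x2 \<notin> span {T x1}" by blast
    \<comment> \<open>This \<open>R\<close> makes \<open>T (R (T x1))\<close> equal to
      \<open>T x2\<close>, which is no multiple of \<open>T x1\<close>; hence
      \<open>T R T - c T\<close> does not vanish at \<open>x1\<close>, for any scalar
      \<open>c\<close>.\<close>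
    obtain R where R: "R \<in> A" "R (T x1) = x2" using transitive[of "T x1" x2] x1 x2 invT by blast
    have lin_TR: "lin (T \<circ> R)" using linT A_lin[OF R(1)] by (rule lin_comp)
    have inv_TR: "(T \<circ> R) ` (T ` W) \<subseteq> T ` W" using invT A_inv[OF R(1)] by force
    obtain z c where z: "z \<in> T ` W" "z \<noteq> 0" "(T \<circ> R) z = c *s z"
      using eigenvector_exists[OF TW _ x1(2) lin_TR inv_TR] x1(1) by blast
    \<comment> \<open>\<open>T R\<close> has an eigenvalue on the range of \<open>T\<close>, so subtracting it lowers the rank of \<open>T R T\<close>.\<close>
    define Q where "Q = (T \<circ> R) - fun_scale c id"
    define T' where "T' = (T \<circ> R \<circ> T) - fun_scale c T"
    have linQ: "lin Q" using lin_TR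
      by (simp add: Q_def lin_iff algebra_simps scale_right_diff_distrib scale_left_commute scale_right_distrib)
    have T'_eq: "T' y = Q (T y)" for y by (simp add: T'_def Q_def)
    have "T \<circ> R \<circ> T \<in> I" using AI[OF AA[OF IA[OF T(1)] R(1)] T(1)] .
    then have T'_I: "T' \<in> I" using T(1) unfolding T'_def I_def by (intro E.span_diff E.span_scale)
    have "T' x1 = T x2 - c *s T x1" by (simp add: T'_def R(2))
    also have "\<dots> \<noteq> 0" using x2(2) by (auto simp: span_singleton)
    finally have "dim (T ` W) \<le> dim (T' ` W)" using min T'_I x1(1) by blast
    also have "T' ` W = Q ` (T ` W)" by (auto simp: T'_eq image_image)
    also have "dim \<dots> < dim (T ` W)"
      by (rule dim_image_less[OF linQ TW z(1,2)]) (use z(3) in \<open>simp add: Q_def\<close>)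
    finally show False by simp
  qed
  have Tx1: "T x1 \<in> W" using x1(1) invT by blast
  \<comment> \<open>With this \<open>R\<close>, the map \<open>T \<circ> R\<close> fixes
    \<open>T x1\<close> and sends \<open>W\<close> into the line through it.\<close>
  then obtain R where R: "R \<in> A" "R (T x1) = x1" using transitive[OF _ x1(2)] x1(1) by blast
  obtain B where B: "finite B" "independent B" "span B = W" using fin_dim_basis[OF W] by blast
  have TR: "T \<circ> R \<in> I" using IA'[OF T(1) R(1)] .
  have "tr B (T \<circ> R) = 0"
    by (rule tr_augmentation[OF B(1,2), of S e])
      (use B(3) lin inv e unip TR in \<open>auto simp: I_def D_def\<close>)
  moreover have "tr B (T \<circ> R) = 1"
  proof (rule tr_rank_one[OF B(1,2), of _ "T x1"])
    show "lin (T \<circ> R)" using TR IA A_lin by blast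
    show "(T \<circ> R) ` span B \<subseteq> span {T x1}" using rank_one A_inv[OF R(1)] B(3) by force
  qed (use Tx1 B(3) x1(2) R(2) in auto)
  ultimately show False by simp
qed

text \<open>The image of \<open>W\<close> under a projection \<open>\<pi>\<close> along \<open>U\<close> replaces the quotient \<open>W / U\<close>.\<close>

lemma unipotent_extend:
  assumes W0: "fin_dim W0"
    and lin: "\<And>s. s \<in> S \<Longrightarrow> lin s"
    and inv: "\<And>s. s \<in> S \<Longrightarrow> s ` W0 \<subseteq> W0"
    and comp: "\<And>s t. s \<in> S \<Longrightarrow> t \<in> S \<Longrightarrow> s \<circ> t \<in> S"
    and e: "e \<in> S" "\<And>x. x \<in> W0 \<Longrightarrow> e x = x"
    and unip: "\<And>s. s \<in> S \<Longrightarrow> \<exists>n. \<forall>x\<in>W0. ((\<lambda>y. s y - y) ^^ n) x = 0"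
    and U: "subspace U" "\<And>s. s \<in> S \<Longrightarrow> s ` U \<subseteq> U" "U \<subset> W0"
  obtains W where "subspace W" "\<And>s. s \<in> S \<Longrightarrow> s ` W \<subseteq> W" "U \<subset> W" "W \<subseteq> W0"
    "\<And>s x. s \<in> S \<Longrightarrow> x \<in> W \<Longrightarrow> s x - x \<in> U"
proof -
  \<comment> \<open>An invariant subspace of least dimension strictly above \<open>U\<close> has an
    irreducible quotient modulo \<open>U\<close>.\<close>
  define P where "P V \<longleftrightarrow> subspace V \<and> (\<forall>s\<in>S. s ` V \<subseteq> V) \<and> U \<subset> V \<and> V \<subseteq> W0" for V
  have "P W0" using fin_dim_subspace[OF W0] inv U(3) by (simp add: P_def)
  then obtain W where "P W" and min: "\<And>V. P V \<Longrightarrow> dim W \<le> dim V"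
    using ex_has_least_nat[of P W0 dim] by metis
  from \<open>P W\<close> have W: "subspace W" "\<And>s. s \<in> S \<Longrightarrow> s ` W \<subseteq> W" "U \<subset> W" "W \<subseteq> W0"
    by (simp_all add: P_def)
  have fdW: "fin_dim W" using fin_dim_subset[OF W0 W(1,4)] .
  have fdU: "fin_dim U" using fin_dim_subset[OF W0 U(1)] U(3) by blast
  obtain \<pi> where \<pi>: "lin \<pi>" "\<And>x. \<pi> x = 0 \<longleftrightarrow> x \<in> U" "\<And>x. x - \<pi> x \<in> U"
    using projection_along[OF fdU] by blast
  \<comment> \<open>Since \<open>\<pi> x\<close> and \<open>x\<close> differ by an element of the
    invariant subspace \<open>U\<close>, \<open>\<pi>\<close> intertwines \<open>s\<close> with
    \<open>\<pi> \<circ> s\<close>. Hence the maps \<open>\<pi> \<circ> s\<close> are again closed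
    under composition, and unipotent on the image of \<open>W\<close>.\<close>
  have key: "\<pi> (s (\<pi> x)) = \<pi> (s x)" if "s \<in> S" for s x
  proof -
    have "s (x - \<pi> x) \<in> U" using U(2)[OF that] \<pi>(3) by blast
    then show ?thesis using \<pi>(2)[of "s (x - \<pi> x)"] by (simp add: lin_diff \<pi>(1) lin[OF that])
  qed
  have \<pi>W: "\<pi> x \<in> W" if "x \<in> W" for x
    using subspace_diff[OF W(1) that, of "x - \<pi> x"] \<pi>(3)[of x] W(3) by auto
  have funpow: "((\<lambda>y. (\<pi> \<circ> s) y - y) ^^ n) (\<pi> x) = \<pi> (((\<lambda>y. s y - y) ^^ n) x)" if "s \<in> S" for s n x
    by (induction n) (simp_all add: key[OF that] lin_diff[OF \<pi>(1)])
  have triv: "(\<pi> \<circ> s) y = y" if s: "s \<in> S" and y: "y \<in> \<pi> ` W" for s y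
  proof (rule unipotent_irreducible[of "\<pi> ` W" "(\<circ>) \<pi> ` S" "\<pi> \<circ> e"])
    show "fin_dim (\<pi> ` W)" using lin_image_fin_dim[OF \<pi>(1) fdW] .
    show "lin t" if "t \<in> (\<circ>) \<pi> ` S" for t using that lin lin_comp[OF \<pi>(1)] by blast
    show "t ` \<pi> ` W \<subseteq> \<pi> ` W" if "t \<in> (\<circ>) \<pi> ` S" for t
      using that \<pi>W W(2) by (auto simp: image_subset_iff)
    show "t \<circ> t' \<in> (\<circ>) \<pi> ` S" if tt: "t \<in> (\<circ>) \<pi> ` S" "t' \<in> (\<circ>) \<pi> ` S" for t t'
    proof -
      obtain r r' where r: "t = \<pi> \<circ> r" "t' = \<pi> \<circ> r'" "r \<in> S" "r' \<in> S" using tt by blast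
      have "t \<circ> t' = \<pi> \<circ> (r \<circ> r')" using key[OF r(3)] r(1,2) by (simp add: fun_eq_iff)
      then show ?thesis using comp[OF r(3,4)] by blast
    qed
    show "\<pi> \<circ> e \<in> (\<circ>) \<pi> ` S" using e(1) by blast
    show "(\<pi> \<circ> e) x = x" if "x \<in> \<pi> ` W" for x
      using that key[OF e(1)] e(2) W(4) by auto
    show "\<exists>n. \<forall>x\<in>\<pi> ` W. ((\<lambda>y. t y - y) ^^ n) x = 0" if t: "t \<in> (\<circ>) \<pi> ` S" for t
    proof -
      obtain r where r: "t = \<pi> \<circ> r" "r \<in> S" using t by blast
      obtain n where "\<forall>x\<in>W0. ((\<lambda>y. r y - y) ^^ n) x = 0" using unip[OF r(2)] by blast
      then have "\<forall>x\<in>\<pi> ` W. ((\<lambda>y. t y - y) ^^ n) x = 0"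
        using funpow[OF r(2), of n] W(4) lin_0[OF \<pi>(1)] unfolding r(1) by auto
      then show ?thesis ..
    qed
    show "V = {0} \<or> V = \<pi> ` W"
      if V: "subspace V" "V \<subseteq> \<pi> ` W" and V_inv: "\<And>t. t \<in> (\<circ>) \<pi> ` S \<Longrightarrow> t ` V \<subseteq> V" for V
    proof -
      \<comment> \<open>The preimage of \<open>V\<close> in \<open>W\<close> lies between
        \<open>U\<close> and \<open>W\<close>, so minimality of \<open>W\<close> leaves only the two
        ends.\<close>
      define V' where "V' = {x \<in> W. \<pi> x \<in> V}"
      have sub: "subspace V'"
        using W(1) V(1) by (auto simp: V'_def subspace_def lin_0[OF \<pi>(1)] lin_add[OF \<pi>(1)] lin_scale[OF \<pi>(1)])
      have "s ` V' \<subseteq> V'" if "s \<in> S" for s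
      proof -
        have "(\<pi> \<circ> s) ` V \<subseteq> V" using V_inv that by blast
        then have "\<pi> (s x) \<in> V" if "\<pi> x \<in> V" for x
          using key[OF \<open>s \<in> S\<close>, of x] that by (metis comp_apply image_subset_iff)
        then show ?thesis using W(2)[OF that] by (auto simp: V'_def)
      qed
      moreover have "U \<subseteq> V'"
      proof
        fix u assume "u \<in> U"
        then show "u \<in> V'" using W(3) \<pi>(2)[of u] subspace_0[OF V(1)] by (auto simp: V'_def)
      qed
      moreover have "V' \<subseteq> W" by (auto simp: V'_def)
      ultimately have *: "P V'" if "V' \<noteq> U"
        unfolding P_def using sub that W(4) by (metis psubsetI subset_trans)
      have "V' = U \<or> V' = W"
      proof (rule ccontr)
        assume neq: "\<not> (V' = U \<or> V' = W)"
        then have "V' \<subset> W" by (auto simp: V'_def)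
        then have "dim V' < dim W" by (rule dim_psubset_fin_dim[OF fdW sub])
        moreover have "dim W \<le> dim V'" using min * neq by blast
        ultimately show False by simp
      qed
      then show ?thesis
      proof
        assume "V' = U"
        have "v = 0" if v: "v \<in> V" for v
        proof -
          obtain w where "w \<in> W" "v = \<pi> w" using V(2) v by blast
          then show ?thesis using \<open>V' = U\<close> v \<pi>(2) by (auto simp: V'_def)
        qed
        then show ?thesis using subspace_0[OF V(1)] by blast
      next
        assume "V' = W"
        then show ?thesis using V(2) by (auto simp: V'_def)
      qed
    qed
  qed (use s y in blast)+
  have "s x - x \<in> U" if "s \<in> S" "x \<in> W" for s x
  proof -
    have "\<pi> (s x) = \<pi> x" using triv[OF that(1), of "\<pi> x"] key[OF that(1)] that(2) by simp
    then show ?thesis using \<pi>(2)[of "s x - x"] by (simp add: lin_diff[OF \<pi>(1)])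
  qed
  then show thesis using that W by blast
qed

text \<open>Induction on the codimension of an invariant subspace \<open>U\<close>: products of some
  fixed length carry \<open>W\<close> into a larger \<open>V\<close> on which every
  \<open>s - 1\<close> has values in \<open>U\<close>, and one more factor reaches \<open>U\<close>.
  The case \<open>U = {0}\<close> is the claim.\<close>

lemma kolchin_closed:
  assumes W: "fin_dim W"
    and lin: "\<And>s. s \<in> S \<Longrightarrow> lin s"
    and inv: "\<And>s. s \<in> S \<Longrightarrow> s ` W \<subseteq> W"
    and comp: "\<And>s t. s \<in> S \<Longrightarrow> t \<in> S \<Longrightarrow> s \<circ> t \<in> S"
    and e: "e \<in> S" "\<And>x. x \<in> W \<Longrightarrow> e x = x"
    and unip: "\<And>s. s \<in> S \<Longrightarrow> \<exists>n. \<forall>x\<in>W. ((\<lambda>y. s y - y) ^^ n) x = 0"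
  shows "\<exists>n. \<forall>ss x. set ss \<subseteq> S \<longrightarrow> length ss = n \<longrightarrow> x \<in> W \<longrightarrow> fold (\<lambda>s y. s y - y) ss x = 0"
proof -
  have chain: "\<exists>n. \<forall>ss x. set ss \<subseteq> S \<longrightarrow> length ss = n \<longrightarrow> x \<in> W \<longrightarrow> fold (\<lambda>s y. s y - y) ss x \<in> U"
    if "subspace U" "\<forall>s\<in>S. s ` U \<subseteq> U" "U \<subseteq> W" for U
    using that
  proof (induction "dim W - dim U" arbitrary: U rule: less_induct)
    case less
    show ?case
    proof (cases "U = W")
      case True
      then show ?thesis by (intro exI[of _ 0]) simp
    next
      case False
      then have "U \<subset> W" using less.prems(3) by blast
      obtain V where V: "subspace V" "\<And>s. s \<in> S \<Longrightarrow> s ` V \<subseteq> V" "U \<subset> V" "V \<subseteq> W"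
        and VU: "\<And>s x. s \<in> S \<Longrightarrow> x \<in> V \<Longrightarrow> s x - x \<in> U"
        by (rule unipotent_extend[OF W lin inv comp e unip less.prems(1) _ \<open>U \<subset> W\<close>])
          (use less.prems(2) in auto)
      have "dim U < dim V"
        using dim_psubset_fin_dim[OF fin_dim_subset[OF W V(1,4)] less.prems(1) V(3)] .
      moreover have "dim U < dim W"
        using dim_psubset_fin_dim[OF W less.prems(1) \<open>U \<subset> W\<close>] .
      ultimately have "dim W - dim V < dim W - dim U" by simp
      then obtain n where n: "\<And>ss x. set ss \<subseteq> S \<Longrightarrow> length ss = n \<Longrightarrow> x \<in> W \<Longrightarrow>
          fold (\<lambda>s y. s y - y) ss x \<in> V"
        using less.hyps[of V] V(1,2,4) by meson
      have "fold (\<lambda>s y. s y - y) ss x \<in> U" if ss: "set ss \<subseteq> S" "length ss = Suc n" "x \<in> W" for ss x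
      proof -
        obtain ts s where "ss = ts @ [s]" using ss(2) by (metis length_Suc_conv_rev)
        then show ?thesis using ss n[of ts x] VU by simp
      qed
      then show ?thesis by blast
    qed
  qed
  have "\<forall>s\<in>S. s ` {0} \<subseteq> {0}" using lin_0[OF lin] by simp
  moreover have "{0} \<subseteq> W" using subspace_0[OF fin_dim_subspace[OF W]] by simp
  ultimately show ?thesis using chain[OF subspace_single_0] by simp
qed

end

context linear_endos
begin

text \<open>The coordinate matrices with respect to a basis of \<open>W\<close> are read over the
  algebraic closure. Unipotence carries over, and the conclusion comes back because
  \<open>\<iota>\<close> is injective on \<open>W\<close>.\<close>

lemma kolchin:
  assumes W: "fin_dim W"
    and lin: "\<And>s. s \<in> S \<Longrightarrow> lin s"
    and inv: "\<And>s. s \<in> S \<Longrightarrow> s ` W \<subseteq> W"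
    and comp: "\<And>s t. s \<in> S \<Longrightarrow> t \<in> S \<Longrightarrow> s \<circ> t \<in> S"
    and e: "e \<in> S" "\<And>x. x \<in> W \<Longrightarrow> e x = x"
    and unip: "\<And>s. s \<in> S \<Longrightarrow> \<exists>n. \<forall>x\<in>W. ((\<lambda>y. s y - y) ^^ n) x = 0"
  shows "\<exists>n. \<forall>ss x. set ss \<subseteq> S \<longrightarrow> length ss = n \<longrightarrow> x \<in> W \<longrightarrow> fold (\<lambda>s y. s y - y) ss x = 0"
proof -
  obtain B where B: "finite B" "independent B" "span B = W" using fin_dim_basis[OF W] by blast
  have BW: "b \<in> W" if "b \<in> B" for b using span_base[OF that] B(3) by simp
  \<comment> \<open>Coordinate vectors are functions on all of \<open>'b\<close>; \<open>ext\<close>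
    uses only their entries at \<open>B\<close>, and the scalar extension of \<open>W\<close> is the
    span \<open>W'\<close> of the images of \<open>B\<close>.\<close>
  define K :: "'a alg_closure \<Rightarrow> ('b \<Rightarrow> 'a alg_closure) \<Rightarrow> 'b \<Rightarrow> 'a alg_closure"
    where "K c x = (\<lambda>b. c * x b)" for c x
  have K [simp]: "K c x b = c * x b" for c x b by (simp add: K_def)
  interpret K: vector_space K
    by unfold_locales (simp_all add: K_def fun_eq_iff algebra_simps)
  interpret K: linear_endos_closed K ..
  \<comment> \<open>\<open>ext s\<close> is the scalar extension of \<open>s\<close>, in coordinates with respect to \<open>B\<close>, and \<open>\<iota>\<close> embeds \<open>W\<close>.\<close>
  define \<iota> where "\<iota> v = (\<lambda>b. to_ac (representation B v b))" for v
  define ext where "ext s x = (\<lambda>c. \<Sum>b\<in>B. x b * \<iota> (s b) c)" for s :: "'b \<Rightarrow> 'b" and x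
  define W' where "W' = K.span (\<iota> ` B)"
  have W': "K.fin_dim W'" unfolding W'_def by (rule K.fin_dim_span) (simp add: B(1))
  have \<iota>_diff: "\<iota> (v - w) = \<iota> v - \<iota> w" if "v \<in> W" "w \<in> W" for v w
    using that B by (simp add: \<iota>_def representation_diff fun_eq_iff)
  have \<iota>_0: "v = 0" if "v \<in> W" "\<iota> v = 0" for v
  proof -
    have "representation B v b = 0" for b using fun_cong[OF that(2), of b] by (simp add: \<iota>_def)
    then show ?thesis using sum_representation_eq[OF B(2) _ B(1), of v] that(1) B(3) by simp
  qed
  have ext_\<iota>: "ext s (\<iota> v) = \<iota> (s v)" if "lin s" "s ` W \<subseteq> W" "v \<in> W" for s v
    using representation_lin[OF B(1,2,2) that(1)] that(2,3) B(3)
    by (simp add: ext_def \<iota>_def fun_eq_iff to_ac_sum)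
  have ext_id: "ext id (\<iota> v) = \<iota> v" if "v \<in> W" for v
    using ext_\<iota>[OF linear_id _ that] by simp
  have \<iota>W': "\<iota> v \<in> W'" if "v \<in> W" for v
  proof -
    have "ext id (\<iota> v) = (\<Sum>b\<in>B. K (\<iota> v b) (\<iota> b))"
      by (simp add: ext_def fun_eq_iff fun_sum_apply)
    also have "\<dots> \<in> W'" unfolding W'_def by (intro K.span_sum K.span_scale K.span_base imageI)
    finally show ?thesis using ext_id[OF that] by simp
  qed
  have ext_lin: "K.lin (ext s)" for s
    by (simp add: K.lin_iff ext_def fun_eq_iff sum.distrib distrib_right sum_distrib_left mult.assoc)
  have ext_comp: "ext s \<circ> ext t = ext (s \<circ> t)" if "s \<in> S" "t \<in> S" for s t
  proof
    fix x
    have "ext t x = (\<Sum>b\<in>B. K (x b) (\<iota> (t b)))" by (simp add: ext_def fun_eq_iff fun_sum_apply)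
    then have "ext s (ext t x) = (\<Sum>b\<in>B. K (x b) (ext s (\<iota> (t b))))"
      by (simp only: K.lin_sum[OF ext_lin] K.lin_scale[OF ext_lin])
    also have "\<dots> = (\<Sum>b\<in>B. K (x b) (\<iota> (s (t b))))"
      using ext_\<iota>[OF lin[OF that(1)] inv[OF that(1)]] inv[OF that(2)] BW
      by (intro sum.cong refl) (metis image_subset_iff)
    finally show "(ext s \<circ> ext t) x = ext (s \<circ> t) x" by (simp add: ext_def fun_eq_iff fun_sum_apply)
  qed
  have eq_on_W': "f x = g x" if "K.lin f" "K.lin g" "x \<in> W'" "\<And>b. b \<in> B \<Longrightarrow> f (\<iota> b) = g (\<iota> b)" for f g x
    using K.lin_eq_on_span[OF that(1,2), of "\<iota> ` B" x] that(3,4) unfolding W'_def by blast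
  have step: "((\<lambda>x. ext s x - x) ^^ n) (\<iota> v) = \<iota> (((\<lambda>x. s x - x) ^^ n) v) \<and> ((\<lambda>x. s x - x) ^^ n) v \<in> W"
    if "s \<in> S" "v \<in> W" for s v n
    using ext_\<iota>[OF lin[OF that(1)] inv[OF that(1)]] \<iota>_diff inv[OF that(1)] fin_dim_subspace[OF W] that(2)
    by (induction n) (auto simp: image_subset_iff intro!: subspace_diff)
  have "\<exists>n. \<forall>ss x. set ss \<subseteq> ext ` S \<longrightarrow> length ss = n \<longrightarrow> x \<in> W' \<longrightarrow> fold (\<lambda>s y. s y - y) ss x = 0"
  proof (rule K.kolchin_closed[OF W', of "ext ` S" "ext e"])
    show "K.lin t" if "t \<in> ext ` S" for t using that ext_lin by blast
    show "t ` W' \<subseteq> W'" if t: "t \<in> ext ` S" for t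
    proof -
      obtain s where s: "s \<in> S" "t = ext s" using t by blast
      have "ext s x \<in> W'" for x
      proof -
        have "ext s x = (\<Sum>b\<in>B. K (x b) (\<iota> (s b)))" by (simp add: ext_def fun_eq_iff fun_sum_apply)
        then show ?thesis
          using \<iota>W' BW inv[OF s(1)] unfolding W'_def by (auto intro!: K.span_sum K.span_scale)
      qed
      then show ?thesis using s(2) by blast
    qed
    show "t \<circ> t' \<in> ext ` S" if "t \<in> ext ` S" "t' \<in> ext ` S" for t t'
      using that ext_comp comp by (auto intro!: imageI)
    show "ext e \<in> ext ` S" using e(1) by blast
    show "ext e x = x" if "x \<in> W'" for x
      using eq_on_W'[OF ext_lin K.linear_id that, of e] ext_\<iota>[OF lin[OF e(1)] inv[OF e(1)]] e(2) BW by simp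
    show "\<exists>n. \<forall>x\<in>W'. ((\<lambda>y. t y - y) ^^ n) x = 0" if t: "t \<in> ext ` S" for t
    proof -
      obtain s where s: "s \<in> S" "t = ext s" using t by blast
      obtain n where n: "\<forall>x\<in>W. ((\<lambda>y. s y - y) ^^ n) x = 0" using unip[OF s(1)] by blast
      \<comment> \<open>Powers of \<open>ext s - 1\<close> are linear, so it is enough that the
        \<open>n\<close>-th one vanishes on the images of the basis, where \<open>step\<close>
        applies.\<close>
      have lin_pow: "K.lin ((\<lambda>x. ext s x - x) ^^ k)" for k
      proof (induction k)
        case (Suc k)
        have "K.lin (\<lambda>x. ext s x - x)"
          using ext_lin[of s] by (simp add: K.lin_iff algebra_simps K.scale_right_diff_distrib)
        from K.lin_comp[OF this Suc.IH] show ?case by (simp only: funpow.simps(2))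
      qed (simp only: funpow.simps(1) K.linear_id)
      have "((\<lambda>x. ext s x - x) ^^ n) (\<iota> b) = 0" if "b \<in> B" for b
      proof -
        have "((\<lambda>x. ext s x - x) ^^ n) (\<iota> b) = \<iota> 0" using step[OF s(1) BW[OF that]] n BW[OF that] by simp
        also have "\<dots> = 0" by (simp add: \<iota>_def representation_zero fun_eq_iff)
        finally show ?thesis .
      qed
      moreover have "K.lin (\<lambda>_. 0)" by (simp add: K.lin_iff)
      ultimately have "((\<lambda>x. ext s x - x) ^^ n) x = 0" if "x \<in> W'" for x
        using eq_on_W'[OF lin_pow _ that, of "\<lambda>_. 0"] by blast
      then show ?thesis using s(2) by blast
    qed
  qed
  then obtain n where n: "\<And>ss x. set ss \<subseteq> ext ` S \<Longrightarrow> length ss = n \<Longrightarrow> x \<in> W' \<Longrightarrow>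
      fold (\<lambda>s y. s y - y) ss x = 0" by blast
  \<comment> \<open>Products of factors \<open>s - 1\<close> commute with \<open>\<iota>\<close>, so
    their vanishing on \<open>W'\<close> can be pulled back to \<open>W\<close>.\<close>
  have fold_\<iota>: "fold (\<lambda>s y. s y - y) (map ext ss) (\<iota> v) = \<iota> (fold (\<lambda>s y. s y - y) ss v) \<and>
      fold (\<lambda>s y. s y - y) ss v \<in> W" if "set ss \<subseteq> S" "v \<in> W" for ss v
    using that
  proof (induction ss arbitrary: v)
    case (Cons s ss)
    have "s v \<in> W" using Cons.prems inv by auto
    then have "s v - v \<in> W" using Cons.prems(2) fin_dim_subspace[OF W] by (simp add: subspace_diff)
    moreover have "ext s (\<iota> v) - \<iota> v = \<iota> (s v - v)"
      using ext_\<iota>[of s v] \<iota>_diff[of "s v" v] \<open>s v \<in> W\<close> Cons.prems lin inv by simp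
    ultimately show ?case
      using Cons.IH[of "s v - v"] Cons.prems(1)
      by (simp only: list.map fold_simps list.set insert_subset)
  qed simp
  have "fold (\<lambda>s y. s y - y) ss x = 0" if "set ss \<subseteq> S" "length ss = n" "x \<in> W" for ss x
    using n[of "map ext ss" "\<iota> x"] fold_\<iota>[OF that(1,3)] \<iota>_0 \<iota>W'[OF that(3)] that(1,2) by auto
  then show ?thesis by blast
qed

end

section \<open>Infinite words\<close>

lemma list_less_append1: "us < xs \<Longrightarrow> length vs = length ys \<Longrightarrow> us @ vs < xs @ ys"
  for us xs :: "'a::order list"
  unfolding list_less_def by (rule lenlex_append1)

lemma list_less_append2: "us @ xs < us @ ys \<longleftrightarrow> xs < ys"
  for us xs :: "'a::order list"
  unfolding list_less_def by (rule lenlex_append2) (auto simp: irrefl_def)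

lemma list_less_length: "length xs < length ys \<Longrightarrow> xs < ys"
  by (simp add: list_less_def lenlex_conv)

lemma list_less_context:
  fixes u v :: "'a::order list"
  assumes "u < v"
  shows "x @ u @ y < x @ v @ y"
  using list_less_append1[OF assms, of y y] by (simp add: list_less_append2)

text \<open>Shirshov's notion of a \<open>d\<close>-decomposable word. Permutations are encoded as
  rearrangements \<open>js\<close> of the list of indices, which are also the summands of the
  multilinear identity below.\<close>

definition decomposable :: "nat \<Rightarrow> 'a::order list \<Rightarrow> bool" where
  "decomposable d w \<longleftrightarrow> (\<exists>vs. length vs = d \<and> w = concat vs \<and>
     (\<forall>js. mset js = mset [0..<d] \<longrightarrow> js \<noteq> [0..<d] \<longrightarrow> concat (map ((!) vs) js) < w))"

text \<open>All indices below the first deviation \<open>m\<close> are already used in their own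
  places, so the index found there exceeds \<open>m\<close>.\<close>

lemma first_difference:
  assumes "mset js = mset [0..<d]" "js \<noteq> [0..<d]"
  obtains m j rest where "js = [0..<m] @ j # rest" "m < j" "j < d"
proof -
  have len: "length js = d" using mset_eq_length[OF assms(1)] by simp
  have "\<exists>i<d. js ! i \<noteq> i" using assms(2) len by (auto simp: list_eq_iff_nth_eq)
  then obtain m where m: "m < d" "js ! m \<noteq> m" and least: "\<And>i. i < m \<Longrightarrow> js ! i = i"
    using exists_least_iff[of "\<lambda>i. i < d \<and> js ! i \<noteq> i"] by (metis order_less_trans)
  have "take m js = [0..<m]"
    using m(1) len least by (intro nth_equalityI) auto
  then have js: "js = [0..<m] @ js ! m # drop (Suc m) js"
    using id_take_nth_drop[of m js] m(1) len by simp
  have "distinct js" using mset_eq_imp_distinct_iff[OF assms(1)] by simp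
  then have "js ! m \<notin> {0..<m}"
    using js by (metis distinct_append disjoint_iff list.set_intros(1) atLeastLessThan_upt)
  moreover have "js ! m < d" using m(1) len assms(1) by (metis atLeastLessThan_iff mset_eq_setD nth_mem set_upt)
  ultimately show thesis using that[OF js] m(2) by auto
qed

text \<open>At its first deviation a permutation puts a block with a smaller prefix in place of
  \<open>vs ! m\<close>. The rearranged word has the same length, so this prefix decides the
  comparison.\<close>

lemma decomposableI:
  assumes len: "length vs = d" "length xs = d"
    and pre: "\<And>i. i < d \<Longrightarrow> length (xs ! i) = n \<and> (\<exists>y. vs ! i = xs ! i @ y)"
    and desc: "\<And>i j. i < j \<Longrightarrow> j < d \<Longrightarrow> xs ! j < xs ! i"
  shows "decomposable d (concat vs)"
  unfolding decomposable_def
proof (intro exI conjI allI impI)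
  fix js assume js: "mset js = mset [0..<d]" "js \<noteq> [0..<d]"
  obtain m j rest where m: "js = [0..<m] @ j # rest" "m < j" "j < d"
    using first_difference[OF js] by blast
  have vs: "vs = map ((!) vs) [0..<d]" using len(1) by (metis map_nth)
  have upt: "[0..<d] = [0..<m] @ m # [Suc m..<d]"
    using m(2,3) by (metis le_add1 less_imp_le less_trans upt_add_eq_append upt_conv_Cons add_0 le_add_diff_inverse)
  have "mset (map ((!) vs) js) = mset (map ((!) vs) [0..<d])" using js(1) by (metis mset_map)
  then have len_eq: "length (concat (map ((!) vs) js)) = length (concat (map ((!) vs) [0..<d]))"
    unfolding length_concat by (metis mset_map sum_mset_sum_list)
  obtain y y' where y: "vs ! m = xs ! m @ y" "vs ! j = xs ! j @ y'" using pre m by (metis less_trans)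
  let ?P = "concat (map ((!) vs) [0..<m])"
  have 1: "concat (map ((!) vs) js) = ?P @ xs ! j @ (y' @ concat (map ((!) vs) rest))"
    by (simp add: m(1) y(2))
  have 2: "concat vs = ?P @ xs ! m @ (y @ concat (map ((!) vs) [Suc m..<d]))"
    by (subst vs, subst upt) (simp add: y(1))
  have "length (xs ! j) = length (xs ! m)" using pre m by simp
  then have "length (y' @ concat (map ((!) vs) rest)) = length (y @ concat (map ((!) vs) [Suc m..<d]))"
    using len_eq vs arg_cong[OF 1, of length] arg_cong[OF 2, of length] by simp
  then show "concat (map ((!) vs) js) < concat vs"
    unfolding 1 2 list_less_append2 by (intro list_less_append1 desc m(2,3))
qed (simp_all add: len)

section \<open>Factors of infinite words over a finite alphabet\<close>

definition window :: "(nat \<Rightarrow> 'a) \<Rightarrow> nat \<Rightarrow> nat \<Rightarrow> 'a list" where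
  "window W n i = map W [i..<i + n]"

definition recurrent :: "(nat \<Rightarrow> 'a) \<Rightarrow> nat \<Rightarrow> 'a list set" where
  "recurrent W n = {x. infinite {i. window W n i = x}}"

lemma length_window [simp]: "length (window W n i) = n"
  by (simp add: window_def)

lemma window_Suc: "window W (Suc n) i = window W n i @ [W (i + n)]"
  by (simp add: window_def)

lemma window_Suc_shift: "window W (Suc n) i = W i # window W n (Suc i)"
  by (simp add: window_def upt_conv_Cons del: upt_Suc)

lemma finite_windows:
  assumes "finite (range W)"
  shows "finite (range (window W n))"
proof (rule finite_subset)
  show "range (window W n) \<subseteq> {xs. set xs \<subseteq> range W \<and> length xs = n}"
    by (auto simp: window_def)
qed (rule finite_lists_length_eq[OF assms])

lemma recurrent_subset: "recurrent W n \<subseteq> range (window W n)"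
  by (auto simp: recurrent_def dest: not_finite_existsD)

lemma eventually_recurrent:
  assumes "finite (range W)"
  shows "\<exists>N. \<forall>i\<ge>N. window W n i \<in> recurrent W n"
proof -
  have "{i. window W n i \<notin> recurrent W n} = (\<Union>x\<in>range (window W n) - recurrent W n. {i. window W n i = x})"
    by auto
  moreover have "finite \<dots>" using finite_windows[OF assms] by (auto simp: recurrent_def)
  ultimately have "finite {i. window W n i \<notin> recurrent W n}" by simp
  then show ?thesis unfolding finite_nat_set_iff_bounded by (auto simp: not_less) (metis not_less)
qed

text \<open>The infinitely many occurrences of \<open>x\<close> are followed by only finitely many
  letters, so one continuation recurs.\<close>

lemma recurrent_extends:
  assumes "finite (range W)" "x \<in> recurrent W n"
  shows "\<exists>a. x @ [a] \<in> recurrent W (Suc n)"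
proof (rule ccontr)
  assume no: "\<nexists>a. x @ [a] \<in> recurrent W (Suc n)"
  have "{i. window W n i = x} = (\<Union>a\<in>range W. {i. window W (Suc n) i = x @ [a]})"
    by (auto simp: window_Suc)
  moreover have "finite \<dots>" using no assms(1) by (intro finite_UN_I) (auto simp: recurrent_def)
  ultimately show False using assms(2) by (simp add: recurrent_def)
qed

text \<open>Take \<open>d\<close> recurrent words of length \<open>n\<close> in decreasing order. By
  recurrence they occur in this order without overlap; cutting \<open>W\<close> where they begin
  gives blocks with decreasing prefixes, as \<open>decomposableI\<close> requires.\<close>

lemma decomposable_of_many_recurrent:
  fixes W :: "nat \<Rightarrow> 'a::linorder"
  assumes fin: "finite (range W)" and many: "d \<le> card (recurrent W n)"
  shows "\<exists>k i. decomposable d (window W k i)"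
proof -
  have finR: "finite (recurrent W n)" using finite_subset[OF recurrent_subset finite_windows[OF fin]] .
  define ys where "ys = rev (sorted_list_of_set (recurrent W n))"
  define xs where "xs = take d ys"
  have ys: "length ys = card (recurrent W n)" "set ys = recurrent W n" "sorted_wrt (>) ys"
    using finR by (simp_all add: ys_def sorted_wrt_rev strict_sorted_list_of_set)
  have xs: "length xs = d" "set xs \<subseteq> recurrent W n"
    using ys many set_take_subset[of d ys] by (auto simp: xs_def)
  have desc: "xs ! j < xs ! i" if "i < j" "j < d" for i j
    using sorted_wrt_nth_less[OF ys(3) that(1)] that many ys(1) by (simp add: xs_def)
  \<comment> \<open>For \<open>k \<ge> d\<close> any sufficiently late position will do. The choice
    can then run over all naturals and also supplies the right end of the last block.\<close>
  have step: "\<exists>q>p. p + n \<le> q \<and> (k < d \<longrightarrow> window W n q = xs ! k)" for p k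
  proof (cases "k < d")
    case True
    then have "xs ! k \<in> recurrent W n" using xs nth_mem[of k xs] by blast
    then have "infinite {i. window W n i = xs ! k}" by (simp add: recurrent_def)
    then obtain q where "q > p + n" "window W n q = xs ! k" unfolding infinite_nat_iff_unbounded by blast
    then show ?thesis by (intro exI[of _ q]) auto
  qed (auto intro: exI[of _ "Suc (p + n)"])
  \<comment> \<open>The start \<open>p 0\<close> is unconstrained: the word \<open>xs ! k\<close> is
    found at \<open>p (Suc k)\<close>, whence the shifted indices in \<open>v\<close>.\<close>
  have "\<exists>p. \<forall>k. True \<and> (p k + n \<le> p (Suc k) \<and> (k < d \<longrightarrow> window W n (p (Suc k)) = xs ! k))"
  proof (rule exE[OF dependent_nat_choice[of "\<lambda>_ _. True"
        "\<lambda>k p q. p + n \<le> q \<and> (k < d \<longrightarrow> window W n q = xs ! k)"]])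
    show "\<exists>q. True \<and> p + n \<le> q \<and> (k < d \<longrightarrow> window W n q = xs ! k)" for p k using step[of p k] by blast
  qed auto
  then obtain p where p: "\<And>k. p k + n \<le> p (Suc k)" "\<And>k. k < d \<Longrightarrow> window W n (p (Suc k)) = xs ! k"
    by blast
  define v where "v k = map W [p (Suc k)..<p (Suc (Suc k))]" for k
  have mono: "p 1 \<le> p (Suc k)" for k
    by (induction k) (use p(1) in \<open>auto intro: order_trans add_leD1\<close>)
  have concat: "concat (map v [0..<k]) = map W [p 1..<p (Suc k)]" for k
  proof (induction k)
    case (Suc k)
    have "[p 1..<p (Suc (Suc k))] = [p 1..<p (Suc k)] @ [p (Suc k)..<p (Suc (Suc k))]"
      using upt_add_eq_append[OF mono[of k], of "p (Suc (Suc k)) - p (Suc k)"] p(1)[of "Suc k"] by simp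
    then show ?case using Suc by (simp add: v_def)
  qed simp
  have "decomposable d (concat (map v [0..<d]))"
  proof (rule decomposableI[of _ d xs n])
    fix i assume i: "i < d"
    have "[p (Suc i)..<p (Suc (Suc i))] = [p (Suc i)..<p (Suc i) + n] @ [p (Suc i) + n..<p (Suc (Suc i))]"
      using upt_add_eq_append[of "p (Suc i)" "p (Suc i) + n" "p (Suc (Suc i)) - (p (Suc i) + n)"] p(1)[of "Suc i"]
      by simp
    then have "v i = window W n (p (Suc i)) @ map W [p (Suc i) + n..<p (Suc (Suc i))]"
      by (simp add: v_def window_def)
    then show "length (xs ! i) = n \<and> (\<exists>y. map v [0..<d] ! i = xs ! i @ y)"
      using p(2)[OF i] i length_window[of W n "p (Suc i)"] by auto
  qed (use xs desc in auto)
  then have "decomposable d (window W (p (Suc d) - p 1) (p 1))"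
    using concat[of d] mono[of d] by (simp add: window_def)
  then show ?thesis by blast
qed

text \<open>A Morse-Hedlund argument: the bounded number of recurrent factors cannot grow at every
  length. At a length \<open>n\<close> where it does not, a recurrent factor determines its next
  letter, and a repetition among late factors makes \<open>W\<close> ultimately periodic.\<close>

lemma powers_of_few_recurrent:
  assumes fin: "finite (range W)" and few: "\<And>n. card (recurrent W n) < d"
  shows "\<exists>u. u \<noteq> [] \<and> (\<forall>k. \<exists>n i. window W n i = concat (replicate k u))"
proof -
  have finR: "finite (recurrent W n)" for n
    using finite_subset[OF recurrent_subset finite_windows[OF fin]] .
  have "\<exists>n. card (recurrent W (Suc n)) \<le> card (recurrent W n)"
  proof (rule ccontr)
    assume "\<not> ?thesis"
    then have "n \<le> card (recurrent W n)" for n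
      by (induction n) (auto simp: not_le Suc_le_eq intro: le_less_trans)
    then show False using few[of d] by (metis not_less)
  qed
  then obtain n where n: "card (recurrent W (Suc n)) \<le> card (recurrent W n)" by blast
  have sub: "recurrent W n \<subseteq> butlast ` recurrent W (Suc n)"
    using recurrent_extends[OF fin] by (metis butlast_snoc image_eqI subsetI)
  \<comment> \<open>Dropping the last letter covers the recurrent words of length \<open>n\<close>,
    which are at least as many as those of length \<open>Suc n\<close>; hence it is
    injective.\<close>
  have "inj_on butlast (recurrent W (Suc n))"
    using card_mono[OF finite_imageI[OF finR] sub] n card_image_le[OF finR, of butlast "Suc n"]
    by (intro eq_card_imp_inj_on finR) linarith
  moreover obtain N where N: "\<And>i. i \<ge> N \<Longrightarrow> window W (Suc n) i \<in> recurrent W (Suc n)"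
    using eventually_recurrent[OF fin] by blast
  ultimately have det: "window W (Suc n) i = window W (Suc n) j"
    if "i \<ge> N" "j \<ge> N" "window W n i = window W n j" for i j
    using that inj_onD[OF _ _ N N, of butlast i j] by (simp add: window_Suc[of W n])
  have "\<not> inj_on (window W n) {N..}"
    using finite_windows[OF fin, of n] finite_imageD[of "window W n" "{N..}"] infinite_Ici[of N]
    by (meson finite_subset image_mono subset_UNIV)
  then obtain i j where ij: "N \<le> i" "i < j" "window W n i = window W n j"
    by (auto simp: inj_on_def) (metis nat_neq_iff)
  have shift: "window W n (i + t) = window W n (j + t)" for t
  proof (induction t)
    case (Suc t)
    then show ?case using det[of "i + t" "j + t"] ij by (simp add: window_Suc_shift)
  qed (use ij in simp)
  have W: "W (i + n + t) = W (j + n + t)" for t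
    using det[OF _ _ shift[of t]] ij by (simp add: window_Suc add.commute add.left_commute)
  define q where "q = j - i"
  have period: "W (i + n + (t + k * q)) = W (i + n + t)" for k t
  proof (induction k)
    case (Suc k)
    have "i + n + (t + Suc k * q) = j + n + (t + k * q)" using ij by (simp add: q_def)
    then show ?case using W[of "t + k * q"] Suc by metis
  qed simp
  define u where "u = window W q (i + n)"
  have "window W (k * q) (i + n) = concat (replicate k u)" for k
  proof (induction k)
    case (Suc k)
    have "[i + n..<i + n + Suc k * q] = [i + n..<i + n + k * q] @ [i + n + k * q..<i + n + k * q + q]"
      using upt_add_eq_append[of "i + n" "i + n + k * q" q] by (simp add: algebra_simps)
    then have "window W (Suc k * q) (i + n) = window W (k * q) (i + n) @ window W q (i + n + k * q)"
      by (simp add: window_def)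
    also have "window W q (i + n + k * q) = u"
      using period[of _ k] by (intro nth_equalityI) (auto simp: u_def window_def algebra_simps)
    finally show ?case using Suc by (simp add: replicate_append_same[symmetric] del: replicate_append_same replicate_Suc)
        (metis concat_append concat.simps append_Nil2 replicate_append_same replicate_Suc)
  qed (simp add: window_def)
  moreover have "u \<noteq> []" using ij by (simp add: u_def q_def window_def)
  ultimately show ?thesis by blast
qed

lemma power_or_decomposable_factor:
  fixes W :: "nat \<Rightarrow> 'a::linorder"
  assumes "finite (range W)"
  shows "(\<exists>n i. decomposable d (window W n i)) \<or>
    (\<exists>u. u \<noteq> [] \<and> (\<forall>k. \<exists>n i. window W n i = concat (replicate k u)))"
proof (cases "\<exists>n. d \<le> card (recurrent W n)")
  case True
  then show ?thesis using decomposable_of_many_recurrent[OF assms] by blast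
next
  case False
  then have "card (recurrent W n) < d" for n by (simp add: not_le)
  then show ?thesis using powers_of_few_recurrent[OF assms] by blast
qed

text \<open>Koenig's lemma for the tree of prefixes of words in \<open>N\<close>: a prefix with
  infinitely many continuations in \<open>N\<close> has a one-letter extension with the same
  property.\<close>

lemma infinite_branch:
  assumes "finite A" "infinite N" "N \<subseteq> lists A"
  obtains W where "range W \<subseteq> A" "\<And>n i. \<exists>x y. x @ window W n i @ y \<in> N"
proof -
  define Q where "Q w \<longleftrightarrow> infinite {v \<in> N. \<exists>z. v = w @ z}" for w
  have step: "\<exists>a\<in>A. Q (w @ [a])" if "Q w" for w
  proof (rule ccontr)
    assume no: "\<not> (\<exists>a\<in>A. Q (w @ [a]))"
    have "{v \<in> N. \<exists>z. v = w @ z} \<subseteq> {w} \<union> (\<Union>a\<in>A. {v \<in> N. \<exists>z. v = (w @ [a]) @ z})"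
    proof
      fix v assume "v \<in> {v \<in> N. \<exists>z. v = w @ z}"
      then obtain z where z: "v \<in> N" "v = w @ z" unfolding mem_Collect_eq by (elim conjE exE)
      show "v \<in> {w} \<union> (\<Union>a\<in>A. {v \<in> N. \<exists>z. v = (w @ [a]) @ z})"
      proof (cases z)
        case (Cons a z')
        then have "a \<in> A" using z assms(3) by auto
        then show ?thesis using z Cons by auto
      qed (use z in simp)
    qed
    moreover have "finite ({w} \<union> (\<Union>a\<in>A. {v \<in> N. \<exists>z. v = (w @ [a]) @ z}))"
      using no assms(1) by (simp add: Q_def)
    ultimately show False using that finite_subset by (auto simp: Q_def)
  qed
  \<comment> \<open>The clause for \<open>n = 0\<close> anchors the branch at the empty word, so
    that \<open>g n\<close> becomes the prefix of \<open>W\<close> of length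
    \<open>n\<close>.\<close>
  have "\<exists>g. \<forall>n. (Q (g n) \<and> (n = 0 \<longrightarrow> g n = [])) \<and> (\<exists>a\<in>A. g (Suc n) = g n @ [a])"
  proof (rule dependent_nat_choice)
    have "{v \<in> N. \<exists>z. v = [] @ z} = N" by auto
    then show "\<exists>w. Q w \<and> (0 = (0::nat) \<longrightarrow> w = [])" using assms(2) by (auto simp: Q_def)
    show "\<exists>v. (Q v \<and> (Suc n = 0 \<longrightarrow> v = [])) \<and> (\<exists>a\<in>A. v = w @ [a])"
      if "Q w \<and> (n = 0 \<longrightarrow> w = [])" for w n
      using step[of w] that by blast
  qed
  then obtain g where Q: "\<And>n. Q (g n)" and g0: "g 0 = []" and g: "\<And>n. \<exists>a\<in>A. g (Suc n) = g n @ [a]"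
    by blast
  define W where "W n = last (g (Suc n))" for n
  have gSuc: "g (Suc n) = g n @ [W n]" "W n \<in> A" for n using g[of n] by (auto simp: W_def)
  have gW: "g n = map W [0..<n]" for n by (induction n) (simp_all add: g0 gSuc(1))
  have "\<exists>x y. x @ window W n i @ y \<in> N" for n i
  proof -
    have "{v \<in> N. \<exists>z. v = g (i + n) @ z} \<noteq> {}" using Q[of "i + n"] unfolding Q_def by (metis finite.emptyI)
    then obtain y where "g (i + n) @ y \<in> N" by blast
    moreover have "g (i + n) = g i @ window W n i"
      using upt_add_eq_append[of 0 i n] by (simp add: gW window_def)
    ultimately show ?thesis by auto
  qed
  then show thesis using that gSuc(2) by blast
qed

section \<open>Multilinear identities\<close>

text \<open>Unless \<open>Y = D\<close>, the terms for \<open>J\<close> and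
  \<open>insert x J\<close> cancel, where \<open>x\<close> is a fixed element of \<open>D\<close>
  outside \<open>Y\<close>.\<close>

lemma alternating_sum_supersets:
  assumes "finite D" "Y \<subseteq> D"
  shows "(\<Sum>J | Y \<subseteq> J \<and> J \<subseteq> D. (-1) ^ card J) = (if Y = D then (-1) ^ card D else (0::'a::ring_1))"
proof (cases "Y = D")
  case True
  then have "{J. Y \<subseteq> J \<and> J \<subseteq> D} = {D}" by auto
  then show ?thesis using True by simp
next
  case False
  then obtain x where x: "x \<in> D" "x \<notin> Y" using assms(2) by blast
  define F where "F = {J. Y \<subseteq> J \<and> J \<subseteq> D - {x}}"
  have fin: "finite F" by (rule finite_subset[of _ "Pow D"]) (auto simp: F_def assms(1))
  have "J \<in> F \<union> insert x ` F" if "Y \<subseteq> J" "J \<subseteq> D" for J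
  proof (cases "x \<in> J")
    case True
    then have "J = insert x (J - {x})" "J - {x} \<in> F" using that x(2) by (auto simp: F_def)
    then show ?thesis by blast
  qed (use that in \<open>auto simp: F_def\<close>)
  then have "{J. Y \<subseteq> J \<and> J \<subseteq> D} = F \<union> insert x ` F" using x(1) by (auto simp: F_def)
  moreover have "F \<inter> insert x ` F = {}" by (auto simp: F_def)
  moreover have "inj_on (insert x) F"
    by (rule inj_onI) (auto simp: F_def insert_ident dest: subsetD)
  moreover have "card (insert x J) = Suc (card J)" if "J \<in> F" for J
  proof -
    have "J \<subseteq> D" "x \<notin> J" using that by (auto simp: F_def)
    then show ?thesis using finite_subset[OF _ assms(1)] by simp
  qed
  ultimately show ?thesis
    using False fin by (simp add: sum.union_disjoint sum.reindex sum_negf)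
qed

text \<open>A list of length at most \<open>d\<close> in which all \<open>d\<close> indices occur
  has no room for repetitions.\<close>

lemma mset_eq_upt_of_set:
  assumes "set js = {..<d}" "length js \<le> d"
  shows "mset js = mset [0..<d]"
proof -
  have "card (set js) = d" using assms(1) by simp
  then have "distinct js" using card_length[of js] assms(2) by (intro card_distinct) simp
  moreover have "set js = set [0..<d]" using assms(1) by (simp add: atLeast0LessThan)
  ultimately show ?thesis using set_eq_iff_mset_eq_distinct[of js "[0..<d]"] by simp
qed

context linear_endos
begin

lemma lin_fold: "(\<And>j. j \<in> set js \<Longrightarrow> lin (h j)) \<Longrightarrow> lin (fold h js)"
proof (induction js)
  case Nil
  then show ?case by (simp add: lin_iff)
next
  case (Cons j js)
  then have "lin (fold h js \<circ> h j)" by (intro lin_comp) auto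
  then show ?case by (simp only: fold_Cons)
qed

lemma finite_index_words: "finite J \<Longrightarrow> finite {js. set js \<subseteq> J \<and> map c js = u}"
  by (rule finite_subset[OF _ finite_lists_length_eq[of J "length u"]]) auto

text \<open>Distributivity: choosing a summand in each factor along \<open>u\<close> amounts to
  choosing a word \<open>js\<close> of indices whose image under \<open>c\<close> is
  \<open>u\<close>.\<close>

lemma fold_substitution:
  assumes "finite J" "\<And>j. j \<in> J \<Longrightarrow> lin (h j)"
  shows "fold (\<lambda>i v. \<Sum>j | j \<in> J \<and> c j = i. h j v) u v =
    (\<Sum>js | set js \<subseteq> J \<and> map c js = u. fold h js v)"
proof (induction u arbitrary: v)
  case Nil
  have "{js. set js \<subseteq> J \<and> map c js = []} = {[]}" by auto
  then show ?case by simp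
next
  case (Cons i u)
  let ?A = "{j. j \<in> J \<and> c j = i}" and ?B = "{js. set js \<subseteq> J \<and> map c js = u}"
  have "fold (\<lambda>i v. \<Sum>j | j \<in> J \<and> c j = i. h j v) (i # u) v = (\<Sum>js\<in>?B. fold h js (\<Sum>j\<in>?A. h j v))"
    using Cons.IH by simp
  also have "\<dots> = (\<Sum>js\<in>?B. \<Sum>j\<in>?A. fold h (j # js) v)"
  proof (rule sum.cong[OF refl])
    fix js assume "js \<in> ?B"
    then have "lin (fold h js)" using assms(2) by (intro lin_fold) auto
    then show "fold h js (\<Sum>j\<in>?A. h j v) = (\<Sum>j\<in>?A. fold h (j # js) v)" by (simp add: lin_sum)
  qed
  also have "\<dots> = (\<Sum>(js, j)\<in>?B \<times> ?A. fold h (j # js) v)"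
    by (simp add: sum.cartesian_product)
  also have "\<dots> = (\<Sum>js | set js \<subseteq> J \<and> map c js = i # u. fold h js v)"
    by (rule sum.reindex_bij_witness[of _ "\<lambda>js. (tl js, hd js)" "\<lambda>(js, j). j # js"])
      (auto simp: map_eq_Cons_conv)
  finally show ?case .
qed

lemma nc_eval_substitution:
  assumes "finite J" "\<And>j. j \<in> J \<Longrightarrow> lin (h j)"
  shows "nc_eval scale p (\<lambda>i v. \<Sum>j | j \<in> J \<and> c j = i. h j v) v =
    (\<Sum>js | set js \<subseteq> J \<and> map c js \<in> Poly_Mapping.keys p. Poly_Mapping.lookup p (map c js) *s fold h js v)"
proof -
  let ?T = "\<lambda>u. {js. set js \<subseteq> J \<and> map c js = u}"
  have "nc_eval scale p (\<lambda>i v. \<Sum>j | j \<in> J \<and> c j = i. h j v) v =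
    (\<Sum>u\<in>Poly_Mapping.keys p. \<Sum>js\<in>?T u. Poly_Mapping.lookup p (map c js) *s fold h js v)"
    by (simp only: nc_eval_def fold_substitution[OF assms] scale_sum_right) (intro sum.cong refl, simp)
  also have "\<dots> = (\<Sum>js\<in>(\<Union>u\<in>Poly_Mapping.keys p. ?T u). Poly_Mapping.lookup p (map c js) *s fold h js v)"
    by (rule sum.UNION_disjoint[symmetric]) (use finite_index_words[OF assms(1)] in auto)
  also have "(\<Union>u\<in>Poly_Mapping.keys p. ?T u) = {js. set js \<subseteq> J \<and> map c js \<in> Poly_Mapping.keys p}" by auto
  finally show ?thesis .
qed

text \<open>
  For a longest monomial \<open>w\<close> of \<open>p\<close>, substitute for $x_i$ the sum of those \<open>h j\<close> with \<open>j \<in> J\<close> and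
  \<open>w ! j = i\<close>. The alternating sum over all sets \<open>J\<close> of positions in \<open>w\<close> retains only the products
  in which every \<open>h j\<close> occurs, hence occurs exactly once, and the coefficient of the product of the
  \<open>h j\<close> in their natural order is that of \<open>w\<close>.
\<close>

lemma multilinear_identity:
  assumes p: "p \<noteq> 0" "\<And>\<phi> v. range \<phi> \<subseteq> E.span S \<Longrightarrow> nc_eval scale p \<phi> v = 0"
    and S: "\<And>s. s \<in> S \<Longrightarrow> lin s"
  shows "\<exists>d. \<forall>h. (\<forall>j<d. h j \<in> S) \<longrightarrow>
    fold h [0..<d] \<in> E.span (fold h ` {js. mset js = mset [0..<d] \<and> js \<noteq> [0..<d]})"
proof -
  have keys: "finite (Poly_Mapping.keys p)" "Poly_Mapping.keys p \<noteq> {}" using p(1) by auto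
  define d where "d = Max (length ` Poly_Mapping.keys p)"
  have "d \<in> length ` Poly_Mapping.keys p" unfolding d_def using keys by (intro Max_in) auto
  then obtain w where w: "w \<in> Poly_Mapping.keys p" "length w = d" by blast
  have max: "length u \<le> d" if "u \<in> Poly_Mapping.keys p" for u
    unfolding d_def using keys that by (intro Max_ge) auto
  show ?thesis
  proof (intro exI[of _ d] allI impI)
    fix h assume "\<forall>j<d. h j \<in> S"
    then have hS: "h j \<in> S" if "j < d" for j using that by blast
    let ?D = "{..<d}"
    let ?c = "(!) w"
    let ?T = "{js. set js \<subseteq> ?D \<and> map ?c js \<in> Poly_Mapping.keys p}"
    define G where "G v js = Poly_Mapping.lookup p (map ?c js) *s fold h js v" for v js
    have finT: "finite ?T"
    proof (rule finite_subset)
      show "?T \<subseteq> {js. set js \<subseteq> ?D \<and> length js \<le> d}" using max by fastforce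
    qed (simp add: finite_lists_length_le)
    \<comment> \<open>This is the identity \<open>p\<close> with sums over \<open>J\<close>
      substituted for its variables; these sums belong to the span of \<open>S\<close>.\<close>
    have sub0: "(\<Sum>js | js \<in> ?T \<and> set js \<subseteq> J. G v js) = 0" if J: "J \<subseteq> ?D" for J v
    proof -
      have finJ: "finite J" using finite_subset[OF J] by simp
      have hJ: "lin (h j)" if "j \<in> J" for j using S hS J that by blast
      have eq: "(\<lambda>v. \<Sum>j | j \<in> J \<and> ?c j = i. h j v) = (\<Sum>j | j \<in> J \<and> ?c j = i. h j)" for i
        by (simp add: fun_eq_iff fun_sum_apply)
      have "(\<lambda>v. \<Sum>j | j \<in> J \<and> ?c j = i. h j v) \<in> E.span S" for i
        unfolding eq using hS J by (intro E.span_sum) (auto intro: E.span_base)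
      then have "nc_eval scale p (\<lambda>i v. \<Sum>j | j \<in> J \<and> ?c j = i. h j v) v = 0"
        by (intro p(2)) blast
      moreover have "{js. js \<in> ?T \<and> set js \<subseteq> J} = {js. set js \<subseteq> J \<and> map ?c js \<in> Poly_Mapping.keys p}"
        using J by auto
      ultimately show ?thesis using nc_eval_substitution[OF finJ hJ, where p = p and c = ?c and v = v]
        by (simp add: G_def)
    qed
    \<comment> \<open>Inclusion-exclusion: after interchanging the sums, the term for
      \<open>js\<close> is multiplied by an alternating sum over the supersets of
      \<open>set js\<close>, which is zero unless all positions occur.\<close>
    have surj0: "(\<Sum>js | js \<in> ?T \<and> set js = ?D. G v js) = 0" for v
    proof -
      have "0 = (\<Sum>J\<in>Pow ?D. (-1) ^ card J *s (\<Sum>js | js \<in> ?T \<and> set js \<subseteq> J. G v js))"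
        using sub0 by simp
      also have "\<dots> = (\<Sum>J\<in>Pow ?D. \<Sum>js\<in>?T. if set js \<subseteq> J then (-1) ^ card J *s G v js else 0)"
      proof (rule sum.cong[OF refl])
        fix J
        show "(-1) ^ card J *s (\<Sum>js | js \<in> ?T \<and> set js \<subseteq> J. G v js) =
            (\<Sum>js\<in>?T. if set js \<subseteq> J then (-1) ^ card J *s G v js else 0)"
          unfolding scale_sum_right by (rule sum.inter_filter[OF finT])
      qed
      also have "\<dots> = (\<Sum>js\<in>?T. \<Sum>J\<in>Pow ?D. if set js \<subseteq> J then (-1) ^ card J *s G v js else 0)"
        by (rule sum.swap)
      also have "\<dots> = (\<Sum>js\<in>?T. if set js = ?D then (-1) ^ d *s G v js else 0)"
      proof (rule sum.cong[OF refl])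
        fix js assume js: "js \<in> ?T"
        have "(\<Sum>J\<in>Pow ?D. if set js \<subseteq> J then (-1) ^ card J *s G v js else 0) =
            (\<Sum>J | J \<in> Pow ?D \<and> set js \<subseteq> J. (-1) ^ card J *s G v js)"
          by (rule sum.inter_filter[symmetric]) simp
        also have "\<dots> = (\<Sum>J | set js \<subseteq> J \<and> J \<subseteq> ?D. (-1) ^ card J) *s G v js"
          unfolding scale_sum_left by (intro sum.cong) auto
        also have "\<dots> = (if set js = ?D then (-1) ^ d else 0) *s G v js"
        proof -
          have "set js \<subseteq> ?D" using js by blast
          from alternating_sum_supersets[OF finite_lessThan this, where 'a = 'a] show ?thesis by (simp only: card_lessThan)
        qed
        finally show "(\<Sum>J\<in>Pow ?D. if set js \<subseteq> J then (-1) ^ card J *s G v js else 0) =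
            (if set js = ?D then (-1) ^ d *s G v js else 0)" by simp
      qed
      also have "\<dots> = (-1) ^ d *s (\<Sum>js | js \<in> ?T \<and> set js = ?D. G v js)"
        unfolding scale_sum_right by (rule sum.inter_filter[OF finT, symmetric])
      finally show ?thesis by simp
    qed
    let ?I = "[0..<d]"
    let ?P = "{js. js \<in> ?T \<and> set js = ?D} - {?I}"
    have map_I: "map ?c ?I = w" using w(2) map_nth[of w] by simp
    then have I: "?I \<in> {js. js \<in> ?T \<and> set js = ?D}" using w(1) by auto
    have fin_surj: "finite {js. js \<in> ?T \<and> set js = ?D}" by (rule finite_subset[OF _ finT]) blast
    \<comment> \<open>The natural order of positions reproduces the monomial \<open>w\<close>, so
      its coefficient is nonzero and the relation can be solved for this product.\<close>
    let ?k = "Poly_Mapping.lookup p w"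
    have "?k \<noteq> 0" using w(1) by (simp add: in_keys_iff)
    have G_I: "G v ?I = ?k *s fold h ?I v" for v by (simp only: G_def map_I)
    have "G v ?I = - (\<Sum>js\<in>?P. G v js)" for v
      using surj0[of v] sum.remove[OF fin_surj I, of "G v"] by (simp only: eq_neg_iff_add_eq_0)
    then have "?k *s fold h ?I v = - (\<Sum>js\<in>?P. Poly_Mapping.lookup p (map ?c js) *s fold h js v)" for v
      unfolding G_I by (simp only: G_def)
    then have "inverse ?k *s (?k *s fold h ?I v) =
        inverse ?k *s - (\<Sum>js\<in>?P. Poly_Mapping.lookup p (map ?c js) *s fold h js v)" for v by simp
    then have "fold h ?I v = inverse ?k *s - (\<Sum>js\<in>?P. Poly_Mapping.lookup p (map ?c js) *s fold h js v)" for v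
      using \<open>?k \<noteq> 0\<close> by simp
    then have "fold h ?I = fun_scale (inverse ?k)
        (- (\<Sum>js\<in>?P. fun_scale (Poly_Mapping.lookup p (map ?c js)) (fold h js)))"
      by (intro ext) (simp only: fun_scale_apply uminus_apply fun_sum_apply)
    also have "\<dots> \<in> E.span (fold h ` {js. mset js = mset ?I \<and> js \<noteq> ?I})"
    proof (intro E.span_scale E.span_neg E.span_sum E.span_base imageI)
      fix js assume js: "js \<in> ?P"
      then have "length js \<le> d" using max by fastforce
      then show "js \<in> {js. mset js = mset ?I \<and> js \<noteq> ?I}" using js mset_eq_upt_of_set by blast
    qed
    finally show "fold h ?I \<in> E.span (fold h ` {js. mset js = mset ?I \<and> js \<noteq> ?I})" .
  qed
qed

end

section \<open>Algebras generated by unipotent elements\<close>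

context linear_endos
begin

text \<open>The rewriting argument for an abstract value \<open>f\<close> of words:
  \<open>ideal\<close> lets linear relations be multiplied by words on both sides, while
  \<open>power\<close> and \<open>decomp\<close> supply relations. Infinitely many irreducible words
  would yield an infinite word without reducible factors, against
  \<open>power_or_decomposable_factor\<close>.\<close>

lemma words_finite_span:
  fixes f :: "'c::wellorder list \<Rightarrow> 'b"
  assumes A: "finite A"
    and ideal: "\<And>x u y T. set x \<subseteq> A \<Longrightarrow> set y \<subseteq> A \<Longrightarrow> f u \<in> span (f ` T) \<Longrightarrow>
      f (x @ u @ y) \<in> span ((\<lambda>t. f (x @ t @ y)) ` T)"
    and power: "\<And>u. set u \<subseteq> A \<Longrightarrow> u \<noteq> [] \<Longrightarrow>
      \<exists>k. f (concat (replicate k u)) \<in> span ((\<lambda>l. f (concat (replicate l u))) ` {..<k})"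
    and decomp: "\<And>vs. length vs = d \<Longrightarrow> set (concat vs) \<subseteq> A \<Longrightarrow> f (concat vs) \<in>
      span ((\<lambda>js. f (concat (map ((!) vs) js))) ` {js. mset js = mset [0..<d] \<and> js \<noteq> [0..<d]})"
  shows "\<exists>F. finite F \<and> f ` lists A \<subseteq> span F"
proof -
  define red where "red w \<longleftrightarrow> f w \<in> span (f ` {u \<in> lists A. u < w})" for w
  define N where "N = {w \<in> lists A. \<not> red w}"
  have red_mono: "red w" if "f w \<in> span (f ` T)" "T \<subseteq> {u \<in> lists A. u < w}" for w T
    using that span_mono[OF image_mono[OF that(2)]] unfolding red_def by blast
  have red_factor: "red (x @ u @ y)" if "red u" "x \<in> lists A" "y \<in> lists A" for x u y
  proof (rule red_mono)
    have "f (x @ u @ y) \<in> span ((\<lambda>t. f (x @ t @ y)) ` {t \<in> lists A. t < u})"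
      by (rule ideal) (use that in \<open>auto simp: red_def\<close>)
    then show "f (x @ u @ y) \<in> span (f ` (\<lambda>t. x @ t @ y) ` {t \<in> lists A. t < u})"
      by (simp add: image_image)
    show "(\<lambda>t. x @ t @ y) ` {t \<in> lists A. t < u} \<subseteq> {v \<in> lists A. v < x @ u @ y}"
      using that list_less_context by auto
  qed
  have "finite N"
  proof (rule ccontr)
    assume "infinite N"
    then obtain W where W: "range W \<subseteq> A" and sub: "\<And>n i. \<exists>x y. x @ window W n i @ y \<in> N"
      using infinite_branch[OF A] unfolding N_def by blast
    have not_red: "\<not> red (window W n i)" for n i
    proof -
      obtain x y where "x @ window W n i @ y \<in> N" using sub by blast
      then show ?thesis using red_factor[of "window W n i" x y] by (auto simp: N_def)
    qed
    have factor_A: "set (window W n i) \<subseteq> A" for n i using W by (auto simp: window_def)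
    have "finite (range W)" using W A finite_subset by blast
    from power_or_decomposable_factor[OF this, of d] show False
    proof (elim disjE exE conjE)
      fix n i assume "decomposable d (window W n i)"
      then obtain vs where vs: "length vs = d" "window W n i = concat vs"
        and less: "\<And>js. mset js = mset [0..<d] \<Longrightarrow> js \<noteq> [0..<d] \<Longrightarrow> concat (map ((!) vs) js) < concat vs"
        unfolding decomposable_def by metis
      let ?J = "{js. mset js = mset [0..<d] \<and> js \<noteq> [0..<d]}"
      have vs_A: "set (concat vs) \<subseteq> A" using factor_A vs(2) by metis
      have "red (concat vs)"
      proof (rule red_mono)
        show "f (concat vs) \<in> span (f ` (\<lambda>js. concat (map ((!) vs) js)) ` ?J)"
          using decomp[OF vs(1) vs_A] by (simp add: image_image)
        have "concat (map ((!) vs) js) \<in> lists A" if "js \<in> ?J" for js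
        proof -
          have "set js = {0..<d}" using that by (metis (mono_tags) mem_Collect_eq mset_eq_setD set_upt)
          then show ?thesis using vs_A vs(1) by (fastforce simp: in_set_conv_nth)
        qed
        then show "(\<lambda>js. concat (map ((!) vs) js)) ` ?J \<subseteq> {u \<in> lists A. u < concat vs}"
          using less by blast
      qed
      then show False using not_red vs(2) by metis
    next
      fix u assume u: "u \<noteq> []" "\<forall>k. \<exists>n i. window W n i = concat (replicate k u)"
      then have in_A: "set (concat (replicate k u)) \<subseteq> A" for k using factor_A by metis
      have u_A: "set u \<subseteq> A" using in_A[of 1] by simp
      obtain k where k: "f (concat (replicate k u)) \<in> span ((\<lambda>l. f (concat (replicate l u))) ` {..<k})"
        using power[OF u_A u(1)] by blast
      \<comment> \<open>Lower powers of the nonempty word \<open>u\<close> are shorter, hence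
        smaller.\<close>
      have "red (concat (replicate k u))"
      proof (rule red_mono)
        show "f (concat (replicate k u)) \<in> span (f ` (\<lambda>l. concat (replicate l u)) ` {..<k})"
          using k by (simp add: image_image)
        show "(\<lambda>l. concat (replicate l u)) ` {..<k} \<subseteq> {v \<in> lists A. v < concat (replicate k u)}"
          using u_A u(1) by (auto simp: length_concat sum_list_replicate intro!: list_less_length)
      qed
      then show False using not_red u(2) by metis
    qed
  qed
  \<comment> \<open>The word order is well-founded, so repeated reduction ends in irreducible
    words.\<close>
  moreover have "f w \<in> span (f ` N)" if "w \<in> lists A" for w
    using that
  proof (induction w rule: less_induct)
    case (less w)
    show ?case
    proof (cases "red w")
      case True
      have "f ` {u \<in> lists A. u < w} \<subseteq> span (f ` N)" using less.IH by blast
      then have "span (f ` {u \<in> lists A. u < w}) \<subseteq> span (f ` N)" by (simp add: span_minimal)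
      then show ?thesis using True by (auto simp: red_def)
    next
      case False
      then show ?thesis using less.prems by (simp add: N_def span_base)
    qed
  qed
  ultimately show ?thesis by (intro exI[of _ "f ` N"]) auto
qed

text \<open>The difference of \<open>(f - 1)^k\<close> and \<open>f^k\<close> involves only powers
  below \<open>k\<close>; for \<open>k = n\<close> the first of these is zero.\<close>

lemma unipotent_power_in_span:
  assumes "lin f" "\<forall>x. ((\<lambda>y. f y - y) ^^ n) x = 0"
  shows "f ^^ n \<in> E.span ((^^) f ` {..<n})"
proof -
  have step: "(\<lambda>y. f y - y) ^^ k - f ^^ k \<in> E.span ((^^) f ` {..<k})" for k
  proof (induction k)
    case 0
    show ?case by (simp only: funpow.simps(1) diff_self E.span_zero)
  next
    case (Suc k)
    let ?r = "(\<lambda>y. f y - y) ^^ k - f ^^ k"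
    have sub: "E.span ((^^) f ` {..<k}) \<subseteq> E.span ((^^) f ` {..<Suc k})"
      by (intro E.span_mono image_mono) auto
    have "f \<circ> g \<in> E.span ((^^) f ` {..<Suc k})" if g: "g \<in> E.span ((^^) f ` {..<k})" for g
    proof (rule comp_in_span[of "{f}", OF _ _ _ g])
      show "h \<circ> y \<in> E.span ((^^) f ` {..<Suc k})" if hy: "h \<in> {f}" "y \<in> (^^) f ` {..<k}" for h y
      proof -
        obtain l where "l < k" "y = f ^^ l" using hy(2) by blast
        then have "h \<circ> y = f ^^ Suc l" "Suc l \<in> {..<Suc k}" using hy(1) by auto
        then show ?thesis by (metis E.span_base imageI)
      qed
    qed (use assms(1) in \<open>auto intro: E.span_base\<close>)
    from this[OF Suc] have "f \<circ> ?r \<in> E.span ((^^) f ` {..<Suc k})" .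
    moreover have "?r \<in> E.span ((^^) f ` {..<Suc k})" using Suc sub by blast
    ultimately have "(f \<circ> ?r) - ?r \<in> E.span ((^^) f ` {..<Suc k})" by (rule E.span_diff)
    moreover have "f ^^ k \<in> E.span ((^^) f ` {..<Suc k})" by (intro E.span_base imageI) simp
    ultimately have "(f \<circ> ?r) - ?r - f ^^ k \<in> E.span ((^^) f ` {..<Suc k})" by (rule E.span_diff)
    also have "(f \<circ> ?r) - ?r - f ^^ k = (\<lambda>y. f y - y) ^^ Suc k - f ^^ Suc k"
      by (simp add: fun_eq_iff lin_diff[OF assms(1)])
    finally show ?case .
  qed
  have "(\<lambda>y. f y - y) ^^ n = 0" using assms(2) by (intro ext) simp
  with step[of n] have "0 - f ^^ n \<in> E.span ((^^) f ` {..<n})" by (simp only:)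
  from E.span_neg[OF this] show ?thesis by (simp only: diff_0 minus_minus)
qed

lemma fold_concat_replicate: "fold a (concat (replicate k u)) = fold a u ^^ k"
proof (induction k)
  case 0
  show ?case by (simp add: fun_eq_iff)
next
  case (Suc k)
  then show ?case by (simp only: replicate.simps concat.simps fold_append funpow_Suc_right)
qed

lemma fold_concat_map: "fold a (concat (map ((!) vs) js)) = fold (\<lambda>j. fold a (vs ! j)) js"
  by (induction js) simp_all

text \<open>Here the endomorphisms themselves are the vectors to which
  \<open>words_finite_span\<close> applies. In the value of \<open>x @ u @ y\<close> the factor of
  \<open>x\<close> acts first, so it stands on the right of the composition.\<close>

lemma span_of_products_finite:
  fixes a :: "'c::wellorder \<Rightarrow> 'b \<Rightarrow> 'b"
  assumes A: "finite A"
    and S: "\<And>s. s \<in> S \<Longrightarrow> lin s" "\<And>s. s \<in> S \<Longrightarrow> \<exists>n. \<forall>x. ((\<lambda>y. s y - y) ^^ n) x = 0"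
    and words: "\<And>w. set w \<subseteq> A \<Longrightarrow> fold a w \<in> S"
    and p: "p \<noteq> 0" "\<And>\<phi> v. range \<phi> \<subseteq> E.span S \<Longrightarrow> nc_eval scale p \<phi> v = 0"
  shows "\<exists>F. finite F \<and> fold a ` lists A \<subseteq> E.span F"
proof -
  interpret EE: linear_endos "fun_scale :: 'a \<Rightarrow> ('b \<Rightarrow> 'b) \<Rightarrow> _" ..
  from multilinear_identity[OF p S(1)]
  obtain d where d: "\<forall>h. (\<forall>j<d. h j \<in> S) \<longrightarrow>
    fold h [0..<d] \<in> E.span (fold h ` {js. mset js = mset [0..<d] \<and> js \<noteq> [0..<d]})" ..
  show ?thesis
  proof (rule EE.words_finite_span[OF A])
    fix x u y and T :: "'c list set"
    assume xy: "set x \<subseteq> A" "set y \<subseteq> A" and u: "fold a u \<in> E.span (fold a ` T)"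
    have lin_y: "lin (fold a y)" using S(1) words[OF xy(2)] by blast
    have "fold a u \<circ> fold a x \<in> E.span ((\<lambda>t. fold a t \<circ> fold a x) ` T)"
      using comp_right_in_span[OF u, of "fold a x"] by (simp only: image_image)
    from comp_left_in_span[OF lin_y this] show "fold a (x @ u @ y) \<in> E.span ((\<lambda>t. fold a (x @ t @ y)) ` T)"
      by (simp only: image_image fold_append comp_assoc)
  next
    fix u assume "set u \<subseteq> A"
    then have "fold a u \<in> S" by (rule words)
    then obtain n where "\<forall>x. ((\<lambda>y. fold a u y - y) ^^ n) x = 0" using S(2) by blast
    from unipotent_power_in_span[OF S(1)[OF \<open>fold a u \<in> S\<close>] this]
    show "\<exists>k. fold a (concat (replicate k u)) \<in> E.span ((\<lambda>l. fold a (concat (replicate l u))) ` {..<k})"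
      unfolding fold_concat_replicate by blast
  next
    fix vs assume vs: "length vs = d" "set (concat vs) \<subseteq> A"
    have vs_S: "fold a (vs ! j) \<in> S" if "j < d" for j
    proof (rule words)
      have "vs ! j \<in> set vs" using that vs(1) by simp
      then show "set (vs ! j) \<subseteq> A" using vs(2) by auto
    qed
    \<comment> \<open>The multilinear identity is applied to whole blocks instead of letters, as
      every product of letters lies in \<open>S\<close>.\<close>
    have "fold (\<lambda>j. fold a (vs ! j)) [0..<d] \<in>
        E.span (fold (\<lambda>j. fold a (vs ! j)) ` {js. mset js = mset [0..<d] \<and> js \<noteq> [0..<d]})"
      by (rule d[rule_format]) (rule vs_S)
    moreover have "fold (\<lambda>j. fold a (vs ! j)) [0..<d] = fold a (concat vs)"
      using fold_concat_map[of a vs "[0..<d]"] vs(1) map_nth[of vs] by simp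
    ultimately show "fold a (concat vs) \<in> E.span ((\<lambda>js. fold a (concat (map ((!) vs) js))) `
        {js. mset js = mset [0..<d] \<and> js \<noteq> [0..<d]})"
      by (simp only: fold_concat_map)
  qed
qed

end

theorem theorem1p19:
  fixes scale :: "'k::field \<Rightarrow> 'v \<Rightarrow> 'v::ab_group_add"
    and G :: "('g, 'm) monoid_scheme"
    and \<rho> :: "'g \<Rightarrow> 'v \<Rightarrow> 'v"
  assumes "group_representation scale G \<rho>"
    and "unipotent_rep G \<rho>"
    and "PI_rep scale G \<rho>"
  shows "locally_unitriangular_rep G \<rho>"
  unfolding locally_unitriangular_rep_def
proof (intro allI impI)
  fix H assume "finitely_generated_subgroup G H"
  then obtain B where H: "subgroup H G" and B: "finite B" "B \<subseteq> carrier G" "H = generate G B"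
    by (auto simp: finitely_generated_subgroup_def)
  interpret group_representation scale G \<rho> by fact
  interpret V: linear_endos scale ..
  interpret EE: linear_endos "V.fun_scale :: 'k \<Rightarrow> ('v \<Rightarrow> 'v) \<Rightarrow> _" ..
  interpret \<rho>: group_hom G "aut_group scale" \<rho>
    by (simp add: group_hom_def group_hom_axioms_def hom group_aut_group is_group vector_space_axioms)
  note [simp del] = \<rho>.hom_one \<rho>.hom_mult
  have \<rho>_lin: "V.lin (\<rho> g)" if "g \<in> carrier G" for g
    using \<rho>.hom_closed[OF that] by (simp add: aut_group_def)
  have "\<one>\<^bsub>aut_group scale\<^esub> = id" unfolding aut_group_def by (simp only: monoid.select_convs)
  then have \<rho>_one: "\<rho> \<one>\<^bsub>G\<^esub> = id" using \<rho>.hom_one by (simp only:)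
  have \<rho>_mult: "\<rho> (g \<otimes>\<^bsub>G\<^esub> h) = \<rho> h \<circ> \<rho> g" if "g \<in> carrier G" "h \<in> carrier G" for g h
    using \<rho>.hom_mult[OF that] by (simp add: aut_group_def)
  have amo: "act_minus_one \<rho> g = (\<lambda>y. \<rho> g y - y)" for g
    by (simp add: act_minus_one_def fun_eq_iff)
  have unip: "\<exists>n. \<forall>x. ((\<lambda>y. \<rho> g y - y) ^^ n) x = 0" if "g \<in> carrier G" for g
    using assms(2) that by (simp add: unipotent_rep_def unipotent_element_def amo)
  obtain p where p: "p \<noteq> 0" "\<And>\<phi> v. range \<phi> \<subseteq> V.E.span (\<rho> ` carrier G) \<Longrightarrow> nc_eval scale p \<phi> v = 0"
    using assms(3) unfolding PI_rep_def PI_algebra_def faithful_image_eq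
    by (auto simp: V.fun_scale_def[abs_def])
  \<comment> \<open>Once inverses are adjoined, products of letters alone give the action of all of
    \<open>H\<close>.\<close>
  define T where "T = B \<union> m_inv G ` B"
  have T: "finite T" "T \<subseteq> carrier G" using B by (auto simp: T_def)
  \<comment> \<open>Letters are numbered, because words need a well-ordered alphabet and
    \<open>'g\<close> carries no order.\<close>
  obtain b where b: "bij_betw b {0..<card T} T" using ex_bij_betw_nat_finite[OF T(1)] by blast
  define A where "A = {0..<card T}"
  have bA: "b ` A = T" using b by (simp add: A_def bij_betw_def)
  define a where "a i = \<rho> (b i)" for i
  have letter: "\<exists>w. set w \<subseteq> A \<and> \<rho> g = fold a w" if gT: "g \<in> T" for g
  proof -
    obtain i where "i \<in> A" "g = b i" using bA gT by blast
    then show ?thesis by (intro exI[of _ "[i]"]) (simp add: a_def)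
  qed
  have H_words: "\<exists>w. set w \<subseteq> A \<and> \<rho> h = fold a w" if "h \<in> H" for h
    using that unfolding B(3)
  proof (induction rule: generate.induct)
    case one
    show ?case by (intro exI[of _ "[]"]) (simp add: \<rho>_one)
  next
    case (incl h)
    then show ?case using letter by (simp add: T_def)
  next
    case (inv h)
    then show ?case using letter by (simp add: T_def)
  next
    case (eng h1 h2)
    then obtain w1 w2 where "set w1 \<subseteq> A" "\<rho> h1 = fold a w1" "set w2 \<subseteq> A" "\<rho> h2 = fold a w2" by blast
    moreover have "h1 \<in> carrier G" "h2 \<in> carrier G"
      using eng.hyps generate_in_carrier[OF B(2)] by blast+
    ultimately show ?case by (intro exI[of _ "w1 @ w2"]) (simp add: \<rho>_mult)
  qed
  have words: "fold a w \<in> \<rho> ` carrier G" if "set w \<subseteq> A" for w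
  proof -
    have "\<exists>g\<in>carrier G. fold a w = \<rho> g"
      using that
    proof (induction w)
      case Nil
      show ?case using \<rho>_one by (intro bexI[of _ "\<one>\<^bsub>G\<^esub>"]) auto
    next
      case (Cons i w)
      then obtain g where g: "g \<in> carrier G" "fold a w = \<rho> g" by auto
      have i: "b i \<in> carrier G" using Cons.prems bA T(2) by auto
      have "fold a (i # w) = \<rho> (b i \<otimes>\<^bsub>G\<^esub> g)"
        unfolding fold_Cons g(2) \<rho>_mult[OF i g(1)] a_def ..
      then show ?case using i g(1) by blast
    qed
    then show ?thesis by blast
  qed
  define M where "M = V.E.span (fold a ` lists A)"
  have "\<exists>F. finite F \<and> fold a ` lists A \<subseteq> V.E.span F"
    by (rule V.span_of_products_finite[of A "\<rho> ` carrier G"])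
      (use \<rho>_lin unip words p in \<open>auto simp: A_def\<close>)
  then obtain F where F: "finite F" "fold a ` lists A \<subseteq> V.E.span F" by blast
  have M: "EE.fin_dim M"
    unfolding EE.fin_dim_def M_def using F V.E.span_minimal[OF F(2)] by auto
  \<comment> \<open>As \<open>V\<close> may be infinite-dimensional, Kolchin's theorem is applied to
    the action of \<open>H\<close> by composition on the finite-dimensional space
    \<open>M\<close>.\<close>
  define L where "L h = (\<lambda>f :: 'v \<Rightarrow> 'v. \<rho> h \<circ> f)" for h
  have HG: "h \<in> carrier G" if "h \<in> H" for h using subgroup.subset[OF H] that by blast
  \<comment> \<open>Evaluated at a point, powers of \<open>L h - 1\<close> are powers of
    \<open>\<rho> h - 1\<close>, so \<open>L h\<close> is unipotent with the same exponent.\<close>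
  have L_diff: "((\<lambda>f. L h f - f) ^^ n) f x = ((\<lambda>y. \<rho> h y - y) ^^ n) (f x)" for h n f x
    by (induction n) (simp_all add: L_def)
  have "\<exists>n. \<forall>ss x. set ss \<subseteq> L ` H \<longrightarrow> length ss = n \<longrightarrow> x \<in> M \<longrightarrow> fold (\<lambda>s y. s y - y) ss x = 0"
  proof (rule EE.kolchin[OF M, of "L ` H" "L \<one>\<^bsub>G\<^esub>"])
    show "EE.lin s" if "s \<in> L ` H" for s
    proof -
      obtain h where h: "h \<in> H" "s = L h" using \<open>s \<in> L ` H\<close> by blast
      show ?thesis using \<rho>_lin[OF HG[OF h(1)]]
        by (simp add: h(2) EE.lin_iff L_def fun_eq_iff V.lin_iff)
    qed
    show "s ` M \<subseteq> M" if "s \<in> L ` H" for s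
    proof
      fix f' assume "f' \<in> s ` M"
      then obtain h f where h: "h \<in> H" "f \<in> M" "f' = \<rho> h \<circ> f" using \<open>s \<in> L ` H\<close> by (auto simp: L_def)
      obtain w where w: "set w \<subseteq> A" "\<rho> h = fold a w" using H_words[OF h(1)] by blast
      have "fold a w \<circ> f \<in> V.E.span (fold a ` lists A)"
      proof (rule V.comp_in_span[of "{\<rho> h}" "fold a ` lists A"])
        show "s \<circ> t \<in> V.E.span (fold a ` lists A)" if "s \<in> {\<rho> h}" "t \<in> fold a ` lists A" for s t
        proof -
          obtain w' where "w' \<in> lists A" "t = fold a w'" using \<open>t \<in> fold a ` lists A\<close> by blast
          then have "s \<circ> t = fold a (w' @ w)" "w' @ w \<in> lists A" using that(1) w by auto
          then show ?thesis by (metis V.E.span_base imageI)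
        qed
        show "V.lin s" if "s \<in> {\<rho> h}" for s using that \<rho>_lin[OF HG[OF h(1)]] by simp
        show "fold a w \<in> V.E.span {\<rho> h}" unfolding w(2) by (rule V.E.span_base) simp
        show "f \<in> V.E.span (fold a ` lists A)" using h(2) by (simp only: M_def)
      qed
      then show "f' \<in> M" using h(3) w(2) by (simp add: M_def)
    qed
    show "s \<circ> t \<in> L ` H" if st: "s \<in> L ` H" "t \<in> L ` H" for s t
    proof -
      obtain h k where hk: "h \<in> H" "k \<in> H" "s = L h" "t = L k" using st by blast
      \<comment> \<open>The right action turns composition around, hence the order of
        \<open>k\<close> and \<open>h\<close>.\<close>
      have "s \<circ> t = L (k \<otimes>\<^bsub>G\<^esub> h)" using hk HG by (simp add: L_def fun_eq_iff \<rho>_mult)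
      then show ?thesis using subgroup.m_closed[OF H hk(2,1)] by blast
    qed
    show "L \<one>\<^bsub>G\<^esub> \<in> L ` H" using subgroup.one_closed[OF H] by blast
    show "L \<one>\<^bsub>G\<^esub> f = f" for f by (simp add: L_def \<rho>_one)
    show "\<exists>n. \<forall>f\<in>M. ((\<lambda>f. s f - f) ^^ n) f = 0" if "s \<in> L ` H" for s
    proof -
      obtain h where h: "h \<in> H" "s = L h" using \<open>s \<in> L ` H\<close> by blast
      obtain n where "\<forall>x. ((\<lambda>y. \<rho> h y - y) ^^ n) x = 0" using unip[OF HG[OF h(1)]] by blast
      then have "((\<lambda>f. s f - f) ^^ n) f = 0" for f
        unfolding h(2) by (intro ext) (simp only: L_diff zero_fun_apply)
      then show ?thesis by blast
    qed
  qed
  then obtain n where n: "\<And>ss f. set ss \<subseteq> L ` H \<Longrightarrow> length ss = n \<Longrightarrow> f \<in> M \<Longrightarrow>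
      fold (\<lambda>s y. s y - y) ss f = 0" by blast
  have fold_L: "fold (\<lambda>s y. s y - y) (map L gs) f v = fold (act_minus_one \<rho>) gs (f v)" for gs f v
  proof (induction gs arbitrary: f)
    case (Cons g gs)
    have "fold (\<lambda>s y. s y - y) (map L (g # gs)) f v = fold (\<lambda>s y. s y - y) (map L gs) (L g f - f) v"
      by (simp only: list.map fold_simps)
    also have "\<dots> = fold (act_minus_one \<rho>) gs ((L g f - f) v)" by (rule Cons.IH)
    also have "(L g f - f) v = act_minus_one \<rho> g (f v)" by (simp add: L_def act_minus_one_def)
    finally show ?case by simp
  qed simp
  \<comment> \<open>The empty word puts \<open>id\<close> into \<open>M\<close>; a product of
    factors \<open>L g - 1\<close> that vanishes at \<open>id\<close> gives a vanishing product of
    the factors \<open>g - 1\<close> on \<open>V\<close>.\<close>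
  have "fold a [] \<in> M" unfolding M_def by (intro V.E.span_base imageI) simp
  then have "id \<in> M" by (simp only: fold_Nil)
  have "fold (act_minus_one \<rho>) gs v = 0" if "length gs = n" "set gs \<subseteq> H" for v gs
  proof -
    have "fold (\<lambda>s y. s y - y) (map L gs) id = 0" using that \<open>id \<in> M\<close> by (intro n) auto
    from fun_cong[OF this, of v] show ?thesis unfolding fold_L by simp
  qed
  then show "unitriangular_rep (G\<lparr>carrier := H\<rparr>) \<rho>"
    unfolding unitriangular_rep_def by (intro exI[of _ n]) simp
qed

end
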